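(* Suppose $\eta>0$. Let $\theta=(\theta_t:0\le t\le T)$ be a fluid limit Markov perfect trajectory (FLMP trajectory). Then $\theta$ is a mean field game Nash equilibrium with initial value $\overline\theta=\theta_0$; that is, there exist functions $(u(i,t): i\in\{0,1\},\,0\le t\le T)$ such that $(\theta_t,u(i,t))$ satisfies, for $0\le t\le T$ and $i\in\{0,1\}$, $$\dot\theta_t=(1-\theta_t)\big((u(1,t)-u(0,t))_+ +\eta\big)-\theta_t\big((u(0,t)-u(1,t))_+ +\eta\big),$$ $$-\dot u(i,t)=f(i,\theta_t)-\eta\,(u(i,t)-u(1-i,t))-\tfrac12\big((u(i,t)-u(1-i,t))_+\big)^2,$$ with $u(i,T)=\psi(i,\theta_T)$.
   Context: Fix $T>0$, $\eta\ge 0$, and functions $f,\psi:\{0,1\}\times[0,1]\to\mathbb R$ that are bounded and uniformly Lipschitz continuous in the second argument. Write $a_+=\max(a,0)$. The $N+1$ player game. There are $N+1$ players, each with state in $\{0,1\}$. A state feedback (Markov) control for a player is a nonnegative function $\alpha(i,n,t)$, where $i$ is the player's own state, $n\in\{0,\dots,N\}$ is the number of other players in state 0, and $t\in[0,T]$. A player using control $\alpha$ jumps from $i$ to $1-i$ at rate $\alpha(i,n,t)+\eta$; conditionally on the current states, players jump independently. Each player wishes to minimize $E\big[\int_0^T (f(i(t),\theta_t)+\tfrac12\alpha_t^2)\,dt+\psi(i(T),\theta_T)\big]$, where here $\theta_t$ is the fraction of the other $N$ players in state 0, and $\alpha_t$ is the control value at time $t$. Write $f(i,n)=f(i,n/N)$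 and $\psi(i,n)=\psi(i,n/N)$. The symmetric Markov perfect equilibrium is the profile in which all players use $\alpha^*(i,n,t)=(u(i,n,t)-u(1-i,n,t))_+$, where $u$ is the unique solution of the system of ODEs $$-\dot u(i,n,t)=f(i,n)-\tfrac12\alpha^*(i,n,t)^2+\eta(u(1-i,n,t)-u(i,n,t))+\gamma^+(i,n,t)(u(i,n+1,t)-u(i,n,t))+\gamma^-(i,n,t)(u(i,n-1,t)-u(i,n,t)),$$ $u(i,n,T)=\psi(i,n)$, with $\gamma^+(i,n,t)=(N-n)(\alpha^*(1,n+1-i,t)+\eta)$ and $\gamma^-(i,n,t)=n(\alpha^*(0,n-i,t)+\eta)$. FLMP trajectory. Let $n^N(t)$ denote the number of players in state 0 at time $t$ under this symmetric Markov perfect equilibrium for the $N+1$ player game, for some initial condition depending on $N$. A trajectory $\theta=(\theta_t:0\le t\le T)$ is an FLMP trajectory if for some sequence of initial states with $\lim_{N\to\infty} n^N(0)/N=\theta_0$, for every $\epsilon>0$, $$\lim_{N\to\infty}P\Big[\Big|\tfrac{n^N(t)}{N+1}-\theta_t\Big|<\epsilon\ \text{for all }0\le t\le T\Big]=1.$$ *)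

theory Defs
  imports "HOL-Probability.Probability"
begin

text \<open>
  The states 0 and 1 of a player are natural numbers, so that the other state is \<open>1 - i\<close> and the
  index shifts \<open>n + 1 - i\<close> and \<open>n - i\<close> can be written literally.  Running and terminal costs are
  functions \<open>f i x\<close>, \<open>\<psi> i x\<close> of a state \<open>i\<close> and a fraction \<open>x\<close>; only \<open>i \<in> {0, 1}\<close> and
  \<open>x \<in> {0..1}\<close> are ever relevant.
\<close>

definition admissible_cost :: "(nat \<Rightarrow> real \<Rightarrow> real) \<Rightarrow> bool" where
  "admissible_cost g \<longleftrightarrow>
     (\<forall>i\<in>{0, 1}. bounded (g i ` {0..1})) \<and>
     (\<exists>L. \<forall>i\<in>{0, 1}. L-lipschitz_on {0..1} (g i))"


section \<open>The symmetric Markov perfect equilibrium of the \<open>N + 1\<close> player game\<close>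

definition mpe_control :: "(nat \<Rightarrow> nat \<Rightarrow> real \<Rightarrow> real) \<Rightarrow> nat \<Rightarrow> nat \<Rightarrow> real \<Rightarrow> real" where
  "mpe_control u i n t = max (u i n t - u (1 - i) n t) 0"

definition gamma_up :: "real \<Rightarrow> nat \<Rightarrow> (nat \<Rightarrow> nat \<Rightarrow> real \<Rightarrow> real) \<Rightarrow> nat \<Rightarrow> nat \<Rightarrow> real \<Rightarrow> real" where
  "gamma_up \<eta> N u i n t = real (N - n) * (mpe_control u 1 (n + 1 - i) t + \<eta>)"

definition gamma_down :: "real \<Rightarrow> (nat \<Rightarrow> nat \<Rightarrow> real \<Rightarrow> real) \<Rightarrow> nat \<Rightarrow> nat \<Rightarrow> real \<Rightarrow> real" where
  "gamma_down \<eta> u i n t = real n * (mpe_control u 0 (n - i) t + \<eta>)"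

text \<open>
  Only \<open>n \<le> N\<close> matters.  Every reference to \<open>u\<close> at an index outside \<open>{0..N}\<close>, and every truncated
  subtraction, occurs in a term with the factor \<open>real (N - n) = 0\<close> or \<open>real n = 0\<close>.
  The derivative within \<open>{0..T}\<close> is one-sided at the end points.
\<close>

definition mpe_value ::
  "real \<Rightarrow> real \<Rightarrow> (nat \<Rightarrow> real \<Rightarrow> real) \<Rightarrow> (nat \<Rightarrow> real \<Rightarrow> real) \<Rightarrow> nat
    \<Rightarrow> (nat \<Rightarrow> nat \<Rightarrow> real \<Rightarrow> real) \<Rightarrow> bool" where
  "mpe_value T \<eta> f \<psi> N u \<longleftrightarrow>
     (\<forall>i\<in>{0, 1}. \<forall>n\<le>N.
        u i n T = \<psi> i (real n / real N) \<and>
        (\<forall>t\<in>{0..T}.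
           (u i n has_real_derivative
              - (f i (real n / real N) - 1/2 * (mpe_control u i n t)\<^sup>2
                 + \<eta> * (u (1 - i) n t - u i n t)
                 + gamma_up \<eta> N u i n t * (u i (n + 1) t - u i n t)
                 + gamma_down \<eta> u i n t * (u i (n - 1) t - u i n t))) (at t within {0..T})))"


section \<open>Time-inhomogeneous Markov jump processes with finitely many states\<close>

text \<open>
  \<open>q t x y\<close> is the jump rate from \<open>x\<close> to \<open>y \<noteq> x\<close> at time \<open>t\<close>, and \<open>p s t x y\<close> is the
  probability of being in \<open>y\<close> at time \<open>t\<close> given \<open>x\<close> at time \<open>s\<close>.  These transition probabilities
  are determined by the rates through Kolmogorov's forward equation.
\<close>

definition transition_function ::
  "real \<Rightarrow> 's set \<Rightarrow> (real \<Rightarrow> 's \<Rightarrow> 's \<Rightarrow> real) \<Rightarrow> (real \<Rightarrow> real \<Rightarrow> 's \<Rightarrow> 's \<Rightarrow> real) \<Rightarrow> bool" where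
  "transition_function T S q p \<longleftrightarrow>
     (\<forall>s\<in>{0..T}. \<forall>x\<in>S. \<forall>y\<in>S.
        p s s x y = (if x = y then 1 else 0) \<and>
        (\<forall>t\<in>{s..T}.
           ((\<lambda>r. p s r x y) has_real_derivative
              (\<Sum>z\<in>S - {y}. p s t x z * q t z y) - p s t x y * (\<Sum>z\<in>S - {y}. q t y z))
           (at t within {s..T})))"

definition past_events :: "'w measure \<Rightarrow> 's set \<Rightarrow> (real \<Rightarrow> 'w \<Rightarrow> 's) \<Rightarrow> real \<Rightarrow> 'w set set" where
  "past_events M S X s =
     sigma_sets (space M) {X r -` B \<inter> space M | r B. r \<in> {0..s} \<and> B \<subseteq> S}"

text \<open>
  Paths are right-continuous step functions with left limits, for every \<open>\<omega>\<close>.  As \<open>S\<close> is finite,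
  this makes events that quantify over all \<open>t \<in> {0..T}\<close>, such as the one in the definition of
  FLMP trajectories below, measurable.
\<close>

definition markov_jump_process ::
  "real \<Rightarrow> 's set \<Rightarrow> (real \<Rightarrow> 's \<Rightarrow> 's \<Rightarrow> real) \<Rightarrow> 'w measure \<Rightarrow> (real \<Rightarrow> 'w \<Rightarrow> 's) \<Rightarrow> bool" where
  "markov_jump_process T S q M X \<longleftrightarrow>
     prob_space M \<and>
     (\<forall>t\<in>{0..T}. X t \<in> M \<rightarrow>\<^sub>M count_space S) \<and>
     (\<forall>\<omega>\<in>space M.
        (\<forall>t\<in>{0..<T}. \<forall>\<^sub>F r in at_right t. X r \<omega> = X t \<omega>) \<and>
        (\<forall>t\<in>{0<..T}. \<exists>x. \<forall>\<^sub>F r in at_left t. X r \<omega> = x)) \<and>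
     (\<exists>p. transition_function T S q p \<and>
        (\<forall>s t. 0 \<le> s \<and> s \<le> t \<and> t \<le> T \<longrightarrow>
           (\<forall>A\<in>past_events M S X s. \<forall>x\<in>S. \<forall>y\<in>S.
              measure M {\<omega>\<in>A. X s \<omega> = x \<and> X t \<omega> = y} =
              measure M {\<omega>\<in>A. X s \<omega> = x} * p s t x y)))"


section \<open>The states of the players under the equilibrium\<close>

text \<open>
  A configuration \<open>x\<close> assigns to each of the players \<open>0, \<dots>, N\<close> its state.
\<close>

definition configurations :: "nat \<Rightarrow> (nat \<Rightarrow> nat) set" where
  "configurations N = {..N} \<rightarrow>\<^sub>E {0, 1}"

definition num_zero :: "nat \<Rightarrow> (nat \<Rightarrow> nat) \<Rightarrow> nat" where
  "num_zero N x = card {k\<in>{..N}. x k = 0}"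

definition num_zero_others :: "nat \<Rightarrow> nat \<Rightarrow> (nat \<Rightarrow> nat) \<Rightarrow> nat" where
  "num_zero_others N k x = card {j\<in>{..N} - {k}. x j = 0}"

text \<open>
  All players use the feedback control \<open>\<alpha>\<close>.  Conditionally on the current configuration they jump
  independently, so the configuration changes by the jump of a single player \<open>k\<close>, and it does so at
  that player's rate; transitions that move several players at once have rate 0.
\<close>

definition configuration_rate ::
  "real \<Rightarrow> nat \<Rightarrow> (nat \<Rightarrow> nat \<Rightarrow> real \<Rightarrow> real) \<Rightarrow> real \<Rightarrow> (nat \<Rightarrow> nat) \<Rightarrow> (nat \<Rightarrow> nat) \<Rightarrow> real" where
  "configuration_rate \<eta> N \<alpha> t x y =
     (\<Sum>k\<in>{k\<in>{..N}. y = x(k := 1 - x k)}. \<alpha> (x k) (num_zero_others N k x) t + \<eta>)"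

definition mpe_process ::
  "real \<Rightarrow> real \<Rightarrow> (nat \<Rightarrow> real \<Rightarrow> real) \<Rightarrow> (nat \<Rightarrow> real \<Rightarrow> real) \<Rightarrow> nat \<Rightarrow> (nat \<Rightarrow> nat)
    \<Rightarrow> 'w measure \<Rightarrow> (real \<Rightarrow> 'w \<Rightarrow> nat \<Rightarrow> nat) \<Rightarrow> bool" where
  "mpe_process T \<eta> f \<psi> N x\<^sub>0 M X \<longleftrightarrow>
     (\<exists>u. mpe_value T \<eta> f \<psi> N u \<and>
        markov_jump_process T (configurations N) (configuration_rate \<eta> N (mpe_control u)) M X) \<and>
     x\<^sub>0 \<in> configurations N \<and> (AE \<omega> in M. X 0 \<omega> = x\<^sub>0)"


section \<open>FLMP trajectories and mean field game Nash equilibria\<close>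

text \<open>
  The type argument is the type of the sample points on which the processes are realized.  The limit
  condition depends only on the laws of the processes, which are determined by the initial
  configurations \<open>x\<^sub>0 N\<close>.  The games have \<open>N \<ge> 1\<close>, since \<open>n / N\<close> is meaningless for \<open>N = 0\<close>.
\<close>

definition FLMP_trajectory ::
  "'w itself \<Rightarrow> real \<Rightarrow> real \<Rightarrow> (nat \<Rightarrow> real \<Rightarrow> real) \<Rightarrow> (nat \<Rightarrow> real \<Rightarrow> real)
    \<Rightarrow> (real \<Rightarrow> real) \<Rightarrow> bool" where
  "FLMP_trajectory _ T \<eta> f \<psi> \<theta> \<longleftrightarrow>
     (\<exists>x\<^sub>0 (M :: nat \<Rightarrow> 'w measure) X.
        (\<forall>N\<ge>1. mpe_process T \<eta> f \<psi> N (x\<^sub>0 N) (M N) (X N)) \<and>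
        (\<lambda>N. real (num_zero N (x\<^sub>0 N)) / real N) \<longlonglongrightarrow> \<theta> 0 \<and>
        (\<forall>\<epsilon>>0.
           (\<lambda>N. measure (M N) {\<omega>\<in>space (M N). \<forall>t\<in>{0..T}.
              \<bar>real (num_zero N (X N t \<omega>)) / real (N + 1) - \<theta> t\<bar> < \<epsilon>}) \<longlonglongrightarrow> 1))"

text \<open>
  The requirement \<open>\<theta> t \<in> {0..1}\<close> is implicit in evaluating \<open>f i\<close> and \<open>\<psi> i\<close>, functions on the unit
  interval, at \<open>\<theta> t\<close>.
\<close>

definition mfg_nash_equilibrium ::
  "real \<Rightarrow> real \<Rightarrow> (nat \<Rightarrow> real \<Rightarrow> real) \<Rightarrow> (nat \<Rightarrow> real \<Rightarrow> real)
    \<Rightarrow> real \<Rightarrow> (real \<Rightarrow> real) \<Rightarrow> bool" where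
  "mfg_nash_equilibrium T \<eta> f \<psi> \<theta>\<^sub>0 \<theta> \<longleftrightarrow>
     \<theta> 0 = \<theta>\<^sub>0 \<and> (\<forall>t\<in>{0..T}. \<theta> t \<in> {0..1}) \<and>
     (\<exists>u :: nat \<Rightarrow> real \<Rightarrow> real.
        (\<forall>t\<in>{0..T}.
           (\<theta> has_real_derivative
              (1 - \<theta> t) * (max (u 1 t - u 0 t) 0 + \<eta>) - \<theta> t * (max (u 0 t - u 1 t) 0 + \<eta>))
           (at t within {0..T})) \<and>
        (\<forall>i\<in>{0, 1}.
           u i T = \<psi> i (\<theta> T) \<and>
           (\<forall>t\<in>{0..T}.
              (u i has_real_derivative
                 - (f i (\<theta> t) - \<eta> * (u i t - u (1 - i) t) - 1/2 * (max (u i t - u (1 - i) t) 0)\<^sup>2))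
              (at t within {0..T}))))"

end

theory Submission
  imports Defs
begin

text \<open>
  Let \<open>v\<close> solve the Hamilton--Jacobi--Bellman equation along the limit trajectory \<open>\<theta>\<close>, which is
  Lipschitz because the jump rates are bounded uniformly in \<open>N\<close>.  Along the equilibrium process let
  \<open>W\<close> and \<open>W'\<close> be the means, over the players and the randomness, of the squared error
  \<open>(u - v)\<^sup>2\<close> at the state that a player occupies and at the one that it does not occupy.  As every
  player leaves its state at rate at least \<open>\<eta> > 0\<close>, the generator yields
  \<open>dW/dt \<ge> (\<eta>/2) W' - K W - o(1)\<close> with \<open>K\<close> independent of \<open>N\<close>.  Since \<open>W(T) = o(1)\<close>, both \<open>W\<close>
  and the time integral of \<open>W'\<close> vanish in the limit, so the equilibrium controls converge to
  those derived from \<open>v\<close>, and the mean of the fraction of players in state 0 satisfies the limit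
  equation.  Only the forward equation for the law of the configuration at a fixed time is needed.
\<close>

section \<open>Differential inequalities and equations on an interval\<close>

text \<open>The error \<open>u - v\<close> cannot be expected to be small for every
  \<open>n\<close>: states far from the trajectory have little to do with \<theta>. Moreover the
  other players jump at a total rate of order \<open>N\<close>, so a Gronwall argument for the whole
  system of equations would have constants that grow with \<open>N\<close>. Squaring the error and
  following it along the process removes both obstacles. Only states charged by the law count, and
  the first-order terms of order \<open>N\<close> in the equation for \<open>u\<close> cancel
  against the generator, which leaves nonnegative squares. The price is that a player occupies one
  state at a time, whereas its control depends on the values in both. This is where \<eta> enters: a
  possible jump of the player itself makes the squared error at the other state appear as a gain.
  All errors are measured by one scale \<rho>. For each \<rho> a single game is selected in which
  the fraction deviates from \<theta> by at most \<open>\<rho>\<^sup>2\<close> in mean square at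
  every time; the resulting estimates are multiples of \<rho> with factors that do not depend on the
  game.\<close>

lemma mono_on_interval_if_deriv_nonneg:
  fixes g g' :: "real \<Rightarrow> real"
  assumes g: "\<And>r. r \<in> {0..T} \<Longrightarrow> (g has_real_derivative g' r) (at r within {0..T})"
    and g': "\<And>r. r \<in> {0..T} \<Longrightarrow> 0 \<le> g' r"
    and st: "0 \<le> s" "s \<le> t" "t \<le> T"
  shows "g s \<le> g t"
proof (rule DERIV_nonneg_imp_increasing_open[OF st(2)])
  fix x assume x: "s < x" "x < t"
  then have "x \<in> {0..T}" "x \<in> interior {0..T}"
    using st by auto
  then have "DERIV g x :> g' x" "g' x \<ge> 0"
    using g[of x] g'[of x] by (simp_all only: at_within_interior)
  then show "\<exists>y. DERIV g x :> y \<and> y \<ge> 0"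
    by blast
next
  have "continuous_on {0..T} g"
    using g by (meson DERIV_continuous continuous_on_eq_continuous_within)
  then show "continuous_on {s..t} g"
    by (rule continuous_on_subset) (use st in auto)
qed

lemma abs_diff_le_if_deriv_bounded:
  fixes g g' :: "real \<Rightarrow> real"
  assumes g: "\<And>r. r \<in> {0..T} \<Longrightarrow> (g has_real_derivative g' r) (at r within {0..T})"
    and g': "\<And>r. r \<in> {0..T} \<Longrightarrow> \<bar>g' r\<bar> \<le> K"
    and st: "0 \<le> s" "s \<le> t" "t \<le> T"
  shows "\<bar>g t - g s\<bar> \<le> K * (t - s)"
proof -
  have "K * s - g s \<le> K * t - g t"
  proof (rule mono_on_interval_if_deriv_nonneg[OF _ _ st, where g = "\<lambda>t. K * t - g t" and g' = "\<lambda>r. K - g' r"])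
    show "0 \<le> K - g' r" if "r \<in> {0..T}" for r
      using g'[OF that] by linarith
  qed (auto intro!: derivative_eq_intros g)
  moreover have "K * s + g s \<le> K * t + g t"
  proof (rule mono_on_interval_if_deriv_nonneg[OF _ _ st, where g = "\<lambda>t. K * t + g t" and g' = "\<lambda>r. K + g' r"])
    show "0 \<le> K + g' r" if "r \<in> {0..T}" for r
      using g'[OF that] by linarith
  qed (auto intro!: derivative_eq_intros g)
  ultimately show ?thesis
    by (simp add: abs_le_iff algebra_simps)
qed

text \<open>Squaring removes the kink of the positive part at 0; this is why the maximum principle
  below sums squares.\<close>

lemma has_real_derivative_square_pos_part:
  "((\<lambda>x::real. (max x 0)\<^sup>2) has_real_derivative 2 * max x 0) (at x)"
proof -
  consider "x > 0" | "x < 0" | "x = 0" by linarith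
  then show ?thesis
  proof cases
    case 1
    have "((\<lambda>x::real. x\<^sup>2) has_real_derivative 2 * max x 0) (at x)"
      using 1 by (auto intro!: derivative_eq_intros)
    then show ?thesis
      by (rule has_field_derivative_transform_within_open[where S = "{0<..}"]) (use 1 in auto)
  next
    case 2
    have "((\<lambda>x::real. 0) has_real_derivative 2 * max x 0) (at x)"
      using 2 by (auto intro!: derivative_eq_intros)
    then show ?thesis
      by (rule has_field_derivative_transform_within_open[where S = "{..<0}"]) (use 2 in auto)
  next
    case 3
    have "((\<lambda>h::real. (max h 0)\<^sup>2 / h) \<longlongrightarrow> 0) (at 0)"
    proof (rule Lim_null_comparison)
      show "\<forall>\<^sub>F h in at 0. norm ((max h 0)\<^sup>2 / h :: real) \<le> \<bar>h\<bar>"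
        by (rule always_eventually) (auto simp: max_def power2_eq_square)
      show "((\<lambda>h::real. \<bar>h\<bar>) \<longlongrightarrow> 0) (at 0)"
        by (rule tendsto_eq_intros | simp)+
    qed
    then show ?thesis
      using 3 by (simp add: DERIV_def)
  qed
qed

text \<open>The sum of the squared positive parts satisfies a linear differential inequality backwards
  in time.\<close>

lemma backward_maximum_principle:
  fixes v v' :: "'s \<Rightarrow> real \<Rightarrow> real"
  assumes S: "finite S" and R: "0 \<le> R"
    and v: "\<And>x t. x \<in> S \<Longrightarrow> t \<in> {0..T} \<Longrightarrow>
        (v x has_real_derivative v' x t) (at t within {0..T})"
    and le: "\<And>x t. x \<in> S \<Longrightarrow> t \<in> {0..T} \<Longrightarrow> 0 < v x t \<Longrightarrow>
        - v' x t \<le> R * (\<Sum>y\<in>S. max (v y t) 0)"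
    and terminal: "\<And>x. x \<in> S \<Longrightarrow> v x T \<le> 0"
    and x: "x \<in> S" and t: "t \<in> {0..T}"
  shows "v x t \<le> 0"
proof -
  define E where "E = (\<lambda>t. \<Sum>x\<in>S. (max (v x t) 0)\<^sup>2)"
  define E' where "E' = (\<lambda>t. \<Sum>x\<in>S. 2 * max (v x t) 0 * v' x t)"
  \<comment> \<open>The factor \<open>card S\<close> comes from the Cauchy-Schwarz inequality. Its
    size is harmless, because the terminal value of \<open>E\<close> is exactly 0.\<close>
  define C where "C = 2 * R * card S"
  have E: "(E has_real_derivative E' t) (at t within {0..T})" if "t \<in> {0..T}" for t
    unfolding E_def E'_def
  proof (rule DERIV_sum)
    fix x assume "x \<in> S"
    show "((\<lambda>t. (max (v x t) 0)\<^sup>2) has_real_derivative 2 * max (v x t) 0 * v' x t)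
        (at t within {0..T})"
      using DERIV_chain[OF has_real_derivative_square_pos_part v[OF \<open>x \<in> S\<close> that]]
      by (simp add: o_def)
  qed
  have E': "0 \<le> E' t + C * E t" if t: "t \<in> {0..T}" for t
  proof -
    define A where "A = (\<Sum>y\<in>S. max (v y t) 0)"
    have "- E' t = (\<Sum>x\<in>S. 2 * max (v x t) 0 * (- v' x t))"
      by (simp add: E'_def sum_negf)
    also have "\<dots> \<le> (\<Sum>x\<in>S. max (v x t) 0 * (2 * R * A))"
    proof (rule sum_mono)
      fix x assume "x \<in> S"
      show "2 * max (v x t) 0 * (- v' x t) \<le> max (v x t) 0 * (2 * R * A)"
      proof (cases "0 < v x t")
        case True
        then have "2 * max (v x t) 0 * (- v' x t) \<le> 2 * max (v x t) 0 * (R * A)"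
          unfolding A_def by (intro mult_left_mono le \<open>x \<in> S\<close> t) auto
        then show ?thesis by (simp add: mult_ac)
      qed (simp add: max_def)
    qed
    also have "\<dots> = 2 * R * A\<^sup>2"
      unfolding sum_distrib_right[symmetric] A_def[symmetric] by (simp add: power2_eq_square)
    also have "\<dots> \<le> 2 * R * (card S * E t)"
      using Cauchy_Schwarz_ineq_sum[of "\<lambda>_. 1" "\<lambda>x. max (v x t) 0" S] R
      by (intro mult_left_mono) (auto simp: E_def A_def)
    finally show ?thesis by (simp add: C_def mult_ac)
  qed
  have "exp (C * t) * E t \<le> exp (C * T) * E T"
  proof (rule mono_on_interval_if_deriv_nonneg[where g = "\<lambda>t. exp (C * t) * E t"])
    show "((\<lambda>t. exp (C * t) * E t) has_real_derivative exp (C * r) * (E' r + C * E r))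
        (at r within {0..T})" if "r \<in> {0..T}" for r
      by (auto intro!: derivative_eq_intros E[OF that] simp: algebra_simps)
  qed (use E' t in auto)
  also have "E T = 0"
    using terminal by (auto simp: E_def max_def intro!: sum.neutral)
  finally have "E t \<le> 0"
    by (simp add: mult_le_0_iff not_le[symmetric])
  moreover have "(max (v x t) 0)\<^sup>2 \<le> E t"
    unfolding E_def by (rule member_le_sum) (use S x in auto)
  ultimately have "(max (v x t) 0)\<^sup>2 \<le> 0" by linarith
  then show ?thesis by (simp add: max_def split: if_splits)
qed

section \<open>Terminal value problems, up to the Hamilton-Jacobi-Bellman equation\<close>

text \<open>Picard's theorem with a terminal condition.  Multiplying the unknown function by
  \<open>exp (2 * L * t)\<close> makes the integral operator a contraction on the whole interval.\<close>

lemma lipschitz_ODE_terminal_value: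
  fixes F :: "real \<Rightarrow> real \<Rightarrow> real"
  assumes cont: "continuous_on ({0..T} \<times> UNIV) (\<lambda>(t, y). F t y)"
    and lip: "\<And>t x y. t \<in> {0..T} \<Longrightarrow> \<bar>F t x - F t y\<bar> \<le> L * \<bar>x - y\<bar>"
    and L: "L > 0" and T: "T \<ge> 0"
  shows "\<exists>y. y T = y\<^sub>T \<and> (\<forall>t\<in>{0..T}. (y has_real_derivative F t (y t)) (at t within {0..T}))"
proof -
  \<comment> \<open>For \<open>w t = exp (l * t) * y t\<close> the integral operator has Lipschitz
    constant at most \<open>L / l\<close>, which is 1/2 here.\<close>
  define l where "l = 2 * L"
  have l: "l > 0" using L by (simp add: l_def)
  define h where "h = (\<lambda>(w :: real \<Rightarrow>\<^sub>C real) r. F r (exp (- (l * r)) * w r))"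
  define A where "A = (\<lambda>w s. exp (l * s) * (y\<^sub>T - integral {s..T} (h w)))"
  \<comment> \<open>Bounded continuous functions on the whole line form the complete space; clamping
    the time extends \<open>A w\<close> constantly beyond the interval.\<close>
  define cl where "cl = (\<lambda>t. max 0 (min T t))"
  have cl: "cl t \<in> {0..T}" for t using T by (auto simp: cl_def)
  have hcont: "continuous_on {0..T} (h w)" for w
  proof -
    have "continuous_on {0..T} (\<lambda>r. (\<lambda>(t, y). F t y) (r, exp (- (l * r)) * w r))"
      by (rule continuous_on_compose2[OF cont]) (auto intro!: continuous_intros)
    then show ?thesis by (simp add: h_def)
  qed
  have hderiv: "((\<lambda>s. integral {s..T} (h w)) has_real_derivative - h w t) (at t within {0..T})"
    if "t \<in> {0..T}" for w t
    by (rule integral_has_real_derivative'[OF hcont that])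
  have "continuous_on {0..T} (\<lambda>s. integral {s..T} (h w))" for w
    using hderiv by (meson DERIV_continuous continuous_on_eq_continuous_within)
  then have Acont: "continuous_on {0..T} (A w)" for w
    unfolding A_def by (auto intro!: continuous_intros)
  have Ab: "(\<lambda>t. A w (cl t)) \<in> bcontfun" for w
  proof -
    have "continuous_on UNIV (\<lambda>t. A w (cl t))"
      by (rule continuous_on_compose2[OF Acont]) (use cl in \<open>auto intro!: continuous_intros simp: cl_def\<close>)
    moreover have "bounded (A w ` {0..T})"
      by (rule compact_imp_bounded[OF compact_continuous_image[OF Acont]]) simp
    then have "bounded (range (\<lambda>t. A w (cl t)))"
      by (rule bounded_subset) (use cl in auto)
    ultimately show ?thesis by (simp add: bcontfun_def)
  qed
  define P where "P = (\<lambda>w. Bcontfun (\<lambda>t. A w (cl t)))"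
  have P: "apply_bcontfun (P w) t = A w (cl t)" for w t
    unfolding P_def using Ab by (simp add: Bcontfun_inverse)
  have contr: "dist (P w1) (P w2) \<le> 1/2 * dist w1 w2" for w1 w2
  proof (rule dist_bound)
    fix t
    define s where "s = cl t"
    define d where "d = dist w1 w2"
    have s: "s \<in> {0..T}" using cl by (simp add: s_def)
    have int: "h w integrable_on {s..T}" for w
      by (rule integrable_continuous_real, rule continuous_on_subset[OF hcont]) (use s in auto)
    have E: "((\<lambda>r. L * d * exp (- (l * r))) has_integral
        (L * d) * ((exp (- (l * s)) - exp (- (l * T))) / l)) {s..T}"
    proof -
      have "((\<lambda>r. exp (- (l * r))) has_integral
        (- exp (- (l * T)) / l) - (- exp (- (l * s)) / l)) {s..T}"
        by (rule fundamental_theorem_of_calculus)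
          (use s l in \<open>auto intro!: derivative_eq_intros
            simp: has_real_derivative_iff_has_vector_derivative[symmetric]\<close>)
      then show ?thesis
        by (intro has_integral_mult_right) (simp add: diff_divide_distrib)
    qed
    have "\<bar>integral {s..T} (h w2) - integral {s..T} (h w1)\<bar>
        = norm (integral {s..T} (\<lambda>r. h w2 r - h w1 r))"
      by (simp add: integral_diff int)
    also have "\<dots> \<le> integral {s..T} (\<lambda>r. L * d * exp (- (l * r)))"
    proof (rule integral_norm_bound_integral)
      show "(\<lambda>r. h w2 r - h w1 r) integrable_on {s..T}"
        by (intro integrable_diff int)
      show "(\<lambda>r. L * d * exp (- (l * r))) integrable_on {s..T}"
        using E by blast
      fix r assume r: "r \<in> {s..T}"
      have "\<bar>h w2 r - h w1 r\<bar> \<le> L * \<bar>exp (- (l * r)) * w2 r - exp (- (l * r)) * w1 r\<bar>"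
        unfolding h_def by (rule lip) (use r s in auto)
      also have "\<dots> = L * (exp (- (l * r)) * dist (w1 r) (w2 r))"
        by (simp add: right_diff_distrib[symmetric] abs_mult dist_real_def abs_minus_commute)
      also have "\<dots> \<le> L * (exp (- (l * r)) * d)"
        unfolding d_def using L by (intro mult_left_mono dist_bounded) auto
      finally show "norm (h w2 r - h w1 r) \<le> L * d * exp (- (l * r))"
        by (simp add: mult_ac)
    qed
    also have "\<dots> = (L * d) * ((exp (- (l * s)) - exp (- (l * T))) / l)"
      using E by (rule integral_unique)
    also have "\<dots> = d / 2 * (exp (- (l * s)) - exp (- (l * T)))"
      using L by (simp add: l_def)
    also have "\<dots> \<le> d / 2 * exp (- (l * s))"
      by (intro mult_left_mono) (auto simp: d_def)
    finally have *: "\<bar>integral {s..T} (h w2) - integral {s..T} (h w1)\<bar> \<le> d / 2 * exp (- (l * s))" .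
    have "dist (P w1 t) (P w2 t) =
        exp (l * s) * \<bar>integral {s..T} (h w2) - integral {s..T} (h w1)\<bar>"
      by (simp add: P s_def[symmetric] A_def dist_real_def right_diff_distrib[symmetric] abs_mult)
    also have "\<dots> \<le> exp (l * s) * (d / 2 * exp (- (l * s)))"
      by (intro mult_left_mono *) auto
    also have "\<dots> = 1/2 * d"
      by (simp add: mult_exp_exp)
    finally show "dist (P w1 t) (P w2 t) \<le> 1/2 * dist w1 w2"
      by (simp add: d_def)
  qed
  have "\<exists>!w. P w = w"
    by (rule banach_fix_type[where c = "1/2"]) (use contr in auto)
  then obtain w where w: "P w = w" by blast
  define y where "y = (\<lambda>t. y\<^sub>T - integral {t..T} (h w))"
  have yw: "exp (- (l * t)) * w t = y t" if "t \<in> {0..T}" for t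
  proof -
    have "w t = A w t"
      using P[of w t] w that by (simp add: cl_def)
    then show ?thesis
      by (simp add: A_def y_def mult.assoc[symmetric] mult_exp_exp)
  qed
  have "(y has_real_derivative F t (y t)) (at t within {0..T})" if t: "t \<in> {0..T}" for t
  proof -
    have "(y has_real_derivative h w t) (at t within {0..T})"
      unfolding y_def by (rule derivative_eq_intros hderiv[OF t] refl | simp)+
    also have "h w t = F t (y t)"
      using yw[OF t] by (simp add: h_def)
    finally show ?thesis .
  qed
  moreover have "y T = y\<^sub>T" by (simp add: y_def)
  ultimately show ?thesis by blast
qed

text \<open>The difference \<open>z\<close> of the two values satisfies a closed scalar equation, whose quadratic term
  has the good sign.  Truncating that term at the resulting a priori bound \<open>R\<close> makes it
  Lipschitz.\<close>

lemma HJB_solution_exists: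
  fixes f0 f1 :: "real \<Rightarrow> real"
  assumes f: "continuous_on {0..T} f0" "continuous_on {0..T} f1" and \<eta>: "\<eta> > 0" and T: "T \<ge> 0"
  shows "\<exists>v0 v1. v0 T = a0 \<and> v1 T = a1 \<and>
    (\<forall>t\<in>{0..T}. (v0 has_real_derivative
        - (f0 t - \<eta> * (v0 t - v1 t) - 1/2 * (max (v0 t - v1 t) 0)\<^sup>2)) (at t within {0..T})) \<and>
    (\<forall>t\<in>{0..T}. (v1 has_real_derivative
        - (f1 t - \<eta> * (v1 t - v0 t) - 1/2 * (max (v1 t - v0 t) 0)\<^sup>2)) (at t within {0..T}))"
proof -
  define g where "g = (\<lambda>t. f1 t - f0 t)"
  have g: "continuous_on {0..T} g"
    unfolding g_def by (intro continuous_intros f)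
  have "bounded (g ` {0..T})"
    by (rule compact_imp_bounded[OF compact_continuous_image[OF g]]) simp
  then obtain G where G: "G > 0" "\<And>t. t \<in> {0..T} \<Longrightarrow> \<bar>g t\<bar> \<le> G"
    unfolding bounded_pos by auto
  define zT where "zT = a1 - a0"
  \<comment> \<open>The a priori bound for the difference of the values: a smooth majorant of its
    terminal size, plus the largest possible growth by the cost difference over time
    \<open>T\<close>.\<close>
  define R where "R = sqrt (1 + zT\<^sup>2) + G * T"
  have R: "R > 0"
    using G T by (auto simp: R_def intro!: add_pos_nonneg add_pos_nonneg)
  define c where "c = (\<lambda>y. max (- R) (min R y))"
  have c: "\<bar>c x - c y\<bar> \<le> \<bar>x - y\<bar>" "\<bar>c y\<bar> \<le> R" "0 \<le> y * c y" for x y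
    using R by (auto simp: c_def max_def min_def zero_le_mult_iff)
  \<comment> \<open>The two squared positive parts combine to
    \<open>1/2 * (y * \<bar>y\<bar>)\<close>, since the positive parts of \<open>y\<close> and
    \<open>- y\<close> are never both nonzero. Here \<open>y\<close> is truncated to
    \<open>c y\<close> in that term only.\<close>
  define F where "F = (\<lambda>t y. - g t + 2 * \<eta> * y + 1/2 * (c y * \<bar>c y\<bar>))"
  have "\<exists>z. z T = zT \<and> (\<forall>t\<in>{0..T}. (z has_real_derivative F t (z t)) (at t within {0..T}))"
  proof (rule lipschitz_ODE_terminal_value)
    have "continuous_on ({0..T} \<times> (UNIV::real set)) (\<lambda>p. g (fst p))"
      by (rule continuous_on_compose2[OF g]) (auto intro!: continuous_intros)
    then show "continuous_on ({0..T} \<times> UNIV) (\<lambda>(t, y). F t y)"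
      unfolding F_def c_def case_prod_unfold by (intro continuous_intros)
    show "2 * \<eta> + R > 0" using \<eta> R by auto
    fix t x y
    have "\<bar>c x * \<bar>c x\<bar> - c y * \<bar>c y\<bar>\<bar> \<le> (\<bar>c x\<bar> + \<bar>c y\<bar>) * \<bar>c x - c y\<bar>"
    proof -
      have "c x * \<bar>c x\<bar> - c y * \<bar>c y\<bar> = \<bar>c x\<bar> * (c x - c y) + c y * (\<bar>c x\<bar> - \<bar>c y\<bar>)"
        by (simp add: algebra_simps)
      also have "\<bar>\<dots>\<bar> \<le> \<bar>c x\<bar> * \<bar>c x - c y\<bar> + \<bar>c y\<bar> * \<bar>\<bar>c x\<bar> - \<bar>c y\<bar>\<bar>"
        by (rule order.trans[OF abs_triangle_ineq]) (simp add: abs_mult)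
      also have "\<dots> \<le> \<bar>c x\<bar> * \<bar>c x - c y\<bar> + \<bar>c y\<bar> * \<bar>c x - c y\<bar>"
        by (intro add_mono mult_left_mono) auto
      finally show ?thesis by (simp add: algebra_simps)
    qed
    also have "\<dots> \<le> (R + R) * \<bar>x - y\<bar>"
      by (intro mult_mono add_mono c) (use R in auto)
    finally have "\<bar>1/2 * (c x * \<bar>c x\<bar> - c y * \<bar>c y\<bar>)\<bar> \<le> R * \<bar>x - y\<bar>"
      by (simp add: abs_mult)
    moreover have "F t x - F t y = 2 * \<eta> * (x - y) + 1/2 * (c x * \<bar>c x\<bar> - c y * \<bar>c y\<bar>)"
      by (simp add: F_def algebra_simps)
    moreover have "\<bar>2 * \<eta> * (x - y)\<bar> = 2 * \<eta> * \<bar>x - y\<bar>"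
      using \<eta> by (simp add: abs_mult)
    ultimately show "\<bar>F t x - F t y\<bar> \<le> (2 * \<eta> + R) * \<bar>x - y\<bar>"
      by (simp add: algebra_simps) linarith
  qed (rule T)
  then obtain z where zT: "z T = zT"
    and z: "\<And>t. t \<in> {0..T} \<Longrightarrow> (z has_real_derivative F t (z t)) (at t within {0..T})"
    by blast
  have zcont: "continuous_on {0..T} z"
    using z by (meson DERIV_continuous continuous_on_eq_continuous_within)
  have zR: "\<bar>z t\<bar> \<le> R" if t: "t \<in> {0..T}" for t
  proof -
    \<comment> \<open>A differentiable substitute for the absolute value of \<open>z\<close>. In its
      derivative the noise term and the truncated quadratic term are nonnegative, so only the cost
      difference, bounded by \<open>G\<close>, can lower it.\<close>
    define h where "h = (\<lambda>t. sqrt (1 + (z t)\<^sup>2))"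
    have hpos: "0 < h t" "\<bar>z t\<bar> \<le> h t" for t
      by (auto simp: h_def add_pos_nonneg intro!: real_le_rsqrt)
    have "h t + G * t \<le> h T + G * T"
    proof (rule mono_on_interval_if_deriv_nonneg[where g = "\<lambda>t. h t + G * t" and g' = "\<lambda>r. z r * F r (z r) / h r + G"])
      fix r assume r: "r \<in> {0..T}"
      have "1 + (z r)\<^sup>2 > 0" by (simp add: add_pos_nonneg)
      then have "(h has_real_derivative inverse (sqrt (1 + (z r)\<^sup>2)) / 2 * (2 * z r * F r (z r)))
          (at r within {0..T})"
        unfolding h_def
        by (intro DERIV_chain2[OF DERIV_real_sqrt])
          (auto intro!: derivative_eq_intros z[OF r])
      then have "(h has_real_derivative z r * F r (z r) / h r) (at r within {0..T})"
        by (simp add: h_def field_simps)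
      then show "((\<lambda>t. h t + G * t) has_real_derivative z r * F r (z r) / h r + G)
          (at r within {0..T})"
        by (auto intro!: derivative_eq_intros)
      have "- (G * h r) \<le> - (\<bar>g r\<bar> * \<bar>z r\<bar>)"
        using mult_mono[OF G(2)[OF r] hpos(2)[of r]] G(1) by auto
      also have "\<dots> \<le> - g r * z r"
        using abs_ge_self[of "g r * z r"] by (simp add: abs_mult)
      also have "\<dots> \<le> - g r * z r + 2 * \<eta> * (z r)\<^sup>2 + 1/2 * \<bar>c (z r)\<bar> * (z r * c (z r))"
        using \<eta> c(3)[of "z r"] by simp
      also have "\<dots> = z r * F r (z r)"
        by (simp add: F_def algebra_simps power2_eq_square)
      finally show "0 \<le> z r * F r (z r) / h r + G"
        using hpos(1)[of r] by (simp add: field_simps)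
    qed (use t in auto)
    moreover have "h T + G * T = R"
      by (simp add: h_def R_def zT)
    moreover have "0 \<le> G * t" using G t by simp
    ultimately show ?thesis using hpos(2)[of t] by linarith
  qed
  have Fz: "F t (z t) = - g t + 2 * \<eta> * z t + 1/2 * (z t * \<bar>z t\<bar>)" if "t \<in> {0..T}" for t
  proof -
    have "c (z t) = z t"
      using zR[OF that] by (auto simp: c_def max_def min_def)
    then show ?thesis by (simp add: F_def)
  qed
  \<comment> \<open>With \<open>z\<close> known, both right-hand sides are known functions of time
    and can be integrated. That the results differ by \<open>z\<close> follows from equal
    derivatives and equal terminal values.\<close>
  define d1 where "d1 = (\<lambda>t. - (f1 t - \<eta> * z t - 1/2 * (max (z t) 0)\<^sup>2))"
  define d0 where "d0 = (\<lambda>t. - (f0 t + \<eta> * z t - 1/2 * (max (- z t) 0)\<^sup>2))"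
  define v1 where "v1 = (\<lambda>t. a1 - integral {t..T} d1)"
  define v0 where "v0 = (\<lambda>t. a0 - integral {t..T} d0)"
  have d: "continuous_on {0..T} d0" "continuous_on {0..T} d1"
    unfolding d0_def d1_def by (intro continuous_intros f zcont)+
  have v1: "(v1 has_real_derivative d1 t) (at t within {0..T})" if "t \<in> {0..T}" for t
    unfolding v1_def
    by (rule derivative_eq_intros integral_has_real_derivative'[OF d(2) that] refl | simp)+
  have v0: "(v0 has_real_derivative d0 t) (at t within {0..T})" if "t \<in> {0..T}" for t
    unfolding v0_def
    by (rule derivative_eq_intros integral_has_real_derivative'[OF d(1) that] refl | simp)+
  have vz: "v1 t - v0 t = z t" if t: "t \<in> {0..T}" for t
  proof -
    have "\<bar>(v1 T - v0 T - z T) - (v1 t - v0 t - z t)\<bar> \<le> 0 * (T - t)"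
    proof (rule abs_diff_le_if_deriv_bounded[where g = "\<lambda>t. v1 t - v0 t - z t"])
      show "((\<lambda>t. v1 t - v0 t - z t) has_real_derivative d1 r - d0 r - F r (z r))
          (at r within {0..T})" if "r \<in> {0..T}" for r
        by (intro derivative_intros v0 v1 z that)
      show "\<bar>d1 r - d0 r - F r (z r)\<bar> \<le> 0" if "r \<in> {0..T}" for r
        unfolding Fz[OF that]
        by (auto simp: d1_def d0_def g_def max_def power2_eq_square)
    qed (use t in auto)
    then show ?thesis
      by (simp add: v1_def v0_def zT zT_def)
  qed
  show ?thesis
  proof (rule exI[of _ v0], rule exI[of _ v1], intro conjI ballI)
    fix t assume t: "t \<in> {0..T}"
    have "v0 t - v1 t = - z t" using vz[OF t] by simp
    then show "(v0 has_real_derivative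
        - (f0 t - \<eta> * (v0 t - v1 t) - 1/2 * (max (v0 t - v1 t) 0)\<^sup>2)) (at t within {0..T})"
      using v0[OF t] by (simp add: d0_def)
    show "(v1 has_real_derivative
        - (f1 t - \<eta> * (v1 t - v0 t) - 1/2 * (max (v1 t - v0 t) 0)\<^sup>2)) (at t within {0..T})"
      using v1[OF t] by (simp add: d1_def vz[OF t])
  qed (simp_all add: v0_def v1_def)
qed

section \<open>Generators\<close>

text \<open>Dynkin's formula in its finite form: exchanging the order of summation in the gain terms
  of the forward equation moves the generator from the law to the test function.\<close>

lemma expectation_deriv:
  fixes \<mu> :: "real \<Rightarrow> 's \<Rightarrow> real"
  assumes S: "finite S"
    and \<mu>: "\<And>y. y \<in> S \<Longrightarrow> ((\<lambda>r. \<mu> r y) has_real_derivative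
        (\<Sum>z\<in>S - {y}. \<mu> t z * q z y) - \<mu> t y * (\<Sum>z\<in>S - {y}. q y z)) (at t within I)"
    and \<phi>: "\<And>x. x \<in> S \<Longrightarrow> (\<phi> x has_real_derivative \<phi>' x) (at t within I)"
  shows "((\<lambda>r. \<Sum>x\<in>S. \<mu> r x * \<phi> x r) has_real_derivative
      (\<Sum>x\<in>S. \<mu> t x * (\<phi>' x + (\<Sum>z\<in>S - {x}. q x z * (\<phi> z t - \<phi> x t))))) (at t within I)"
proof -
  define d where "d = (\<lambda>y. (\<Sum>z\<in>S - {y}. \<mu> t z * q z y) - \<mu> t y * (\<Sum>z\<in>S - {y}. q y z))"
  have "((\<lambda>r. \<Sum>x\<in>S. \<mu> r x * \<phi> x r) has_real_derivative
      (\<Sum>x\<in>S. d x * \<phi> x t + \<phi>' x * \<mu> t x)) (at t within I)"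
    using \<mu> \<phi> by (intro DERIV_sum DERIV_mult) (auto simp: d_def)
  also have "(\<Sum>x\<in>S. d x * \<phi> x t + \<phi>' x * \<mu> t x) =
      (\<Sum>x\<in>S. \<mu> t x * (\<phi>' x + (\<Sum>z\<in>S - {x}. q x z * (\<phi> z t - \<phi> x t))))"
  proof -
    have swap: "(\<Sum>y\<in>S. \<Sum>z\<in>S - {y}. \<mu> t z * q z y * \<phi> y t) =
        (\<Sum>x\<in>S. \<Sum>z\<in>S - {x}. \<mu> t x * q x z * \<phi> z t)"
    proof -
      have "(\<Sum>y\<in>S. \<Sum>z\<in>S - {y}. \<mu> t z * q z y * \<phi> y t) =
          (\<Sum>y\<in>S. \<Sum>z | z \<in> S \<and> y \<noteq> z. \<mu> t z * q z y * \<phi> y t)"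
        by (intro sum.cong refl) auto
      also have "\<dots> = (\<Sum>z\<in>S. \<Sum>y | y \<in> S \<and> y \<noteq> z. \<mu> t z * q z y * \<phi> y t)"
        by (rule sum.swap_restrict[OF S S])
      also have "\<dots> = (\<Sum>x\<in>S. \<Sum>z\<in>S - {x}. \<mu> t x * q x z * \<phi> z t)"
        by (intro sum.cong refl) auto
      finally show ?thesis .
    qed
    have "(\<Sum>x\<in>S. d x * \<phi> x t + \<phi>' x * \<mu> t x) =
        (\<Sum>y\<in>S. \<Sum>z\<in>S - {y}. \<mu> t z * q z y * \<phi> y t)
        + (\<Sum>x\<in>S. \<mu> t x * (\<phi>' x - (\<Sum>z\<in>S - {x}. q x z) * \<phi> x t))"
      by (simp add: d_def algebra_simps sum.distrib sum_subtractf sum_distrib_left sum_distrib_right)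
    also have "\<dots> = (\<Sum>x\<in>S. \<mu> t x * (\<phi>' x + (\<Sum>z\<in>S - {x}. q x z * (\<phi> z t - \<phi> x t))))"
      unfolding swap sum.distrib[symmetric]
      by (simp add: algebra_simps sum.distrib sum_subtractf sum_distrib_left sum_distrib_right)
    finally show ?thesis .
  qed
  finally show ?thesis .
qed

definition flip :: "nat \<Rightarrow> (nat \<Rightarrow> nat) \<Rightarrow> nat \<Rightarrow> nat" where
  "flip k x = x(k := 1 - x k)"

lemma finite_configurations: "finite (configurations N)"
  unfolding configurations_def by (intro finite_PiE) auto

lemma configuration_cases:
  assumes "x \<in> configurations N" "k \<le> N"
  obtains "x k = 0" | "x k = 1"
  using assms unfolding configurations_def by (auto dest!: PiE_mem[where x = k])

lemma flip_in_configurations: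
  assumes "x \<in> configurations N" "k \<le> N"
  shows "flip k x \<in> configurations N - {x}"
proof -
  have "flip k x \<in> configurations N"
    using assms unfolding configurations_def flip_def
    by (auto simp: PiE_iff extensional_def)
  moreover have "flip k x k \<noteq> x k"
    using assms by (cases rule: configuration_cases) (auto simp: flip_def)
  ultimately show ?thesis by auto
qed

text \<open>After the exchange of the two sums each player contributes a single target, its own
  flip, which is always a configuration different from \<open>x\<close>.\<close>

lemma configuration_rate_sum:
  assumes x: "x \<in> configurations N"
  shows "(\<Sum>z\<in>configurations N - {x}. configuration_rate \<eta> N \<alpha> t x z * g z) =
    (\<Sum>k\<le>N. (\<alpha> (x k) (num_zero_others N k x) t + \<eta>) * g (flip k x))"
proof -
  have "(\<Sum>z\<in>configurations N - {x}. configuration_rate \<eta> N \<alpha> t x z * g z) =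
      (\<Sum>z\<in>configurations N - {x}. \<Sum>k | k \<in> {..N} \<and> z = flip k x.
        (\<alpha> (x k) (num_zero_others N k x) t + \<eta>) * g (flip k x))"
    unfolding configuration_rate_def sum_distrib_right
    by (intro sum.cong refl) (auto simp: flip_def)
  also have "\<dots> = (\<Sum>k\<le>N. \<Sum>z | z \<in> configurations N - {x} \<and> z = flip k x.
        (\<alpha> (x k) (num_zero_others N k x) t + \<eta>) * g (flip k x))"
    by (rule sum.swap_restrict) (auto simp: finite_configurations)
  also have "\<dots> = (\<Sum>k\<le>N. \<Sum>z\<in>{flip k x}.
        (\<alpha> (x k) (num_zero_others N k x) t + \<eta>) * g (flip k x))"
    using flip_in_configurations[OF x]
    by (intro sum.cong refl) auto
  finally show ?thesis by simp
qed

section \<open>Counting the players in state 0 from the viewpoint of one player\<close>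

lemma num_zero_eq:
  assumes x: "x \<in> configurations N" and k: "k \<le> N"
  shows "num_zero N x = num_zero_others N k x + (1 - x k)"
  using x k
proof (cases rule: configuration_cases)
  case 1
  have "{j\<in>{..N}. x j = 0} = insert k {j\<in>{..N} - {k}. x j = 0}"
    using 1 k by auto
  then show ?thesis
    using 1 by (simp add: num_zero_def num_zero_others_def)
next
  case 2
  have "{j\<in>{..N}. x j = 0} = {j\<in>{..N} - {k}. x j = 0}"
    using 2 by auto
  then show ?thesis
    using 2 by (simp add: num_zero_def num_zero_others_def)
qed

lemma num_zero_others_le: "k \<le> N \<Longrightarrow> num_zero_others N k x \<le> N"
  unfolding num_zero_others_def
  by (rule order.trans[OF card_mono[of "{..N} - {k}"]]) auto

lemma num_zero_others_flip_self [simp]: "num_zero_others N k (flip k x) = num_zero_others N k x"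
  unfolding num_zero_others_def flip_def by (rule arg_cong[where f = card]) auto

lemma num_zero_flip:
  assumes "x \<in> configurations N" "k \<le> N"
  shows "num_zero N (flip k x) = num_zero_others N k x + x k"
proof -
  have "num_zero N (flip k x) = num_zero_others N k (flip k x) + (1 - flip k x k)"
    using flip_in_configurations[OF assms] assms(2) by (intro num_zero_eq) auto
  moreover have "1 - flip k x k = x k"
    using assms by (cases rule: configuration_cases) (auto simp: flip_def)
  ultimately show ?thesis by simp
qed

lemma sum_other_players:
  assumes x: "x \<in> configurations N" and k: "k \<le> N"
  shows "(\<Sum>j\<in>{..N} - {k}. h (x j)) =
    real (N - num_zero_others N k x) * h 1 + real (num_zero_others N k x) * (h 0 :: real)"
proof -
  define Z where "Z = {j\<in>{..N} - {k}. x j = 0}"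
  have Z: "Z \<subseteq> {..N} - {k}" "card Z = num_zero_others N k x"
    by (auto simp: Z_def num_zero_others_def)
  have "card ({..N} - {k} - Z) = N - num_zero_others N k x"
    using Z k by (subst card_Diff_subset) (auto intro: finite_subset)
  moreover have "(\<Sum>j\<in>{..N} - {k} - Z. h (x j)) = (\<Sum>j\<in>{..N} - {k} - Z. h 1)"
    using x by (intro sum.cong refl) (auto simp: Z_def elim: configuration_cases)
  moreover have "(\<Sum>j\<in>Z. h (x j)) = (\<Sum>j\<in>Z. h 0)"
    by (intro sum.cong refl) (auto simp: Z_def)
  ultimately show ?thesis
    using sum.subset_diff[OF Z(1), of "\<lambda>j. h (x j)"] Z(2) by simp
qed

text \<open>The rates at which the other players move are \<open>\<gamma>\<^sup>+\<close> and \<open>\<gamma>\<^sup>-\<close> of the equilibrium equations: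
  a player in state 1 sees player \<open>k\<close> in addition to the \<open>n\<close> players seen by \<open>k\<close>, and a player in
  state 0 does not see itself.\<close>

lemma other_players_generator:
  assumes x: "x \<in> configurations N" and k: "k \<le> N"
  defines "n \<equiv> num_zero_others N k x"
  shows "(\<Sum>j\<in>{..N} - {k}. (mpe_control u (x j) (num_zero_others N j x) t + \<eta>) *
      (g (num_zero_others N k (flip j x)) - g n)) =
    gamma_up \<eta> N u (x k) n t * (g (n + 1) - g n) + gamma_down \<eta> u (x k) n t * (g (n - 1) - g n)"
proof -
  define h where "h = (\<lambda>i. if i = (1::nat)
    then (mpe_control u 1 (n + 1 - x k) t + \<eta>) * (g (n + 1) - g n)
    else (mpe_control u 0 (n - x k) t + \<eta>) * (g (n - 1) - g n))"
  have "(mpe_control u (x j) (num_zero_others N j x) t + \<eta>) *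
      (g (num_zero_others N k (flip j x)) - g n) = h (x j)" if j: "j \<in> {..N} - {k}" for j
  proof -
    have jN: "j \<le> N" using j by simp
    have "flip j x k = x k" using j by (simp add: flip_def)
    \<comment> \<open>The zeros of \<open>flip j x\<close> and of \<open>x\<close> are each counted
      from the viewpoints of \<open>k\<close> and of \<open>j\<close>. If \<open>j\<close> is in
      state 0, it is among the \<open>n\<close> zeros seen by \<open>k\<close>, so
      \<open>n - 1\<close> below is a true subtraction.\<close>
    then have *: "num_zero_others N k (flip j x) + (1 - x k) = num_zero_others N j x + x j"
        "n + (1 - x k) = num_zero_others N j x + (1 - x j)"
      using num_zero_flip[OF x jN] num_zero_eq[OF x jN] num_zero_eq[OF x k]
        num_zero_eq[of "flip j x" N k] flip_in_configurations[OF x jN] k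
      by (auto simp: n_def)
    show ?thesis
      using x jN
    proof (cases rule: configuration_cases)
      case 1
      from x k have "num_zero_others N k (flip j x) = n - 1 \<and> num_zero_others N j x = n - x k"
        by (cases rule: configuration_cases) (use * 1 in auto)
      then show ?thesis using 1 by (simp add: h_def)
    next
      case 2
      from x k have "num_zero_others N k (flip j x) = n + 1 \<and> num_zero_others N j x = n + 1 - x k"
        by (cases rule: configuration_cases) (use * 2 in auto)
      then show ?thesis using 2 by (simp add: h_def)
    qed
  qed
  then have "(\<Sum>j\<in>{..N} - {k}. (mpe_control u (x j) (num_zero_others N j x) t + \<eta>) *
      (g (num_zero_others N k (flip j x)) - g n)) = (\<Sum>j\<in>{..N} - {k}. h (x j))"
    by (rule sum.cong[OF refl])
  also have "\<dots> = real (N - n) * h 1 + real n * h 0"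
    unfolding n_def by (rule sum_other_players[OF x k])
  finally show ?thesis
    by (simp add: h_def gamma_up_def gamma_down_def mult.assoc)
qed

section \<open>The values of the game are bounded uniformly in the number of players\<close>

text \<open>The maximum principle is applied to \<open>\<sigma> * u - K - K * (T - t)\<close> for
  both signs. The linear function of time absorbs the running cost, and the jump terms are
  differences of values with nonnegative rates, so the number of players does not enter the
  bound.\<close>

lemma mpe_value_bounded:
  assumes u: "mpe_value T \<eta> f \<psi> N u" and N: "N \<ge> 1" and \<eta>: "\<eta> \<ge> 0"
    and f: "\<And>i x. i \<in> {0, 1} \<Longrightarrow> x \<in> {0..1} \<Longrightarrow> \<bar>f i x\<bar> \<le> K"
    and \<psi>: "\<And>i x. i \<in> {0, 1} \<Longrightarrow> x \<in> {0..1} \<Longrightarrow> \<bar>\<psi> i x\<bar> \<le> K"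
    and i: "i \<in> {0, 1}" and n: "n \<le> N" and t: "t \<in> {0..T}"
  shows "\<bar>u i n t\<bar> \<le> K + K * (T - t)"
proof -
  define S where "S = {0, 1::nat} \<times> {..N}"
  have S: "finite S" by (simp add: S_def)
  define u' where "u' = (\<lambda>i n t. - (f i (real n / real N) - 1/2 * (mpe_control u i n t)\<^sup>2
                 + \<eta> * (u (1 - i) n t - u i n t)
                 + gamma_up \<eta> N u i n t * (u i (n + 1) t - u i n t)
                 + gamma_down \<eta> u i n t * (u i (n - 1) t - u i n t)))"
  have u': "(u i n has_real_derivative u' i n t) (at t within {0..T})"
    if "i \<in> {0, 1}" "n \<le> N" "t \<in> {0..T}" for i n t
    using u that unfolding mpe_value_def u'_def by blast
  have uT: "u i n T = \<psi> i (real n / real N)" if "i \<in> {0, 1}" "n \<le> N" for i n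
    using u that unfolding mpe_value_def by blast
  have frac: "real n / real N \<in> {0..1}" if "n \<le> N" for n
    using that N by (simp add: divide_simps)
  have "\<exists>B. \<forall>t\<in>{0..T}. \<bar>u (fst p) (snd p) t\<bar> \<le> B" if "p \<in> S" for p
  proof -
    have "continuous_on {0..T} (u (fst p) (snd p))"
      using u' that unfolding S_def
      by (intro DERIV_continuous_on[where D = "u' (fst p) (snd p)"]) auto
    then have "bounded (u (fst p) (snd p) ` {0..T})"
      by (intro compact_imp_bounded compact_continuous_image) auto
    then show ?thesis unfolding bounded_iff by auto
  qed
  then obtain b where b: "\<And>p t. p \<in> S \<Longrightarrow> t \<in> {0..T} \<Longrightarrow> \<bar>u (fst p) (snd p) t\<bar> \<le> b p"
    by metis
  \<comment> \<open>A crude bound from compactness, which may depend on \<open>N\<close>. It enters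
    only the coefficient \<open>R\<close> of the maximum principle, not the resulting
    estimate.\<close>
  define B where "B = (\<Sum>p\<in>S. \<bar>b p\<bar>)"
  have B: "\<bar>u i n t\<bar> \<le> B" if "i \<in> {0, 1}" "n \<le> N" "t \<in> {0..T}" for i n t
  proof -
    have "(i, n) \<in> S" using that by (auto simp: S_def)
    then have "\<bar>u i n t\<bar> \<le> b (i, n)" using b[of "(i, n)" t] that by simp
    also have "\<dots> \<le> \<bar>b (i, n)\<bar>" by simp
    also have "\<dots> \<le> B" unfolding B_def
      by (rule member_le_sum[of "(i, n)"]) (use S \<open>(i, n) \<in> S\<close> in auto)
    finally show ?thesis .
  qed
  have B0: "0 \<le> B" by (simp add: B_def sum_nonneg)
  have \<alpha>: "0 \<le> mpe_control u i n t" "mpe_control u i n t \<le> 2 * B"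
    if "i \<in> {0, 1}" "n \<le> N" "t \<in> {0..T}" for i n t
    using B[OF that] B[of "1 - i" n t] that B0 unfolding mpe_control_def by auto
  define G where "G = real N * (2 * B + \<eta>)"
  have up: "0 \<le> gamma_up \<eta> N u i n t" "gamma_up \<eta> N u i n t \<le> G"
    if "i \<in> {0, 1}" "n \<le> N" "t \<in> {0..T}" for i n t
  proof -
    have *: "0 \<le> mpe_control u 1 (n + 1 - i) t + \<eta> \<and> mpe_control u 1 (n + 1 - i) t + \<eta> \<le> 2 * B + \<eta>"
      if "n < N"
      using \<alpha>[of 1 "n + 1 - i" t] that \<open>t \<in> {0..T}\<close> \<eta> by auto
    show "0 \<le> gamma_up \<eta> N u i n t"
      using * \<open>n \<le> N\<close> unfolding gamma_up_def by (cases "n = N") auto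
    show "gamma_up \<eta> N u i n t \<le> G"
    proof (cases "n = N")
      case True
      then show ?thesis using B0 \<eta> by (simp add: gamma_up_def G_def)
    next
      case False
      then show ?thesis
        using * \<open>n \<le> N\<close> unfolding gamma_up_def G_def by (intro mult_mono) auto
    qed
  qed
  have down: "0 \<le> gamma_down \<eta> u i n t" "gamma_down \<eta> u i n t \<le> G"
    if "i \<in> {0, 1}" "n \<le> N" "t \<in> {0..T}" for i n t
  proof -
    have *: "0 \<le> mpe_control u 0 (n - i) t + \<eta> \<and> mpe_control u 0 (n - i) t + \<eta> \<le> 2 * B + \<eta>"
      using \<alpha>[of 0 "n - i" t] that \<eta> by auto
    show "0 \<le> gamma_down \<eta> u i n t"
      using * unfolding gamma_down_def by auto
    show "gamma_down \<eta> u i n t \<le> G"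
      using * \<open>n \<le> N\<close> unfolding gamma_down_def G_def by (intro mult_mono) auto
  qed
  have main: "\<sigma> * u i n t - K - K * (T - t) \<le> 0" if \<sigma>: "\<sigma> = 1 \<or> \<sigma> = -1" for \<sigma> :: real
  proof -
    define v where "v = (\<lambda>p t. \<sigma> * u (fst p) (snd p) t - K - K * (T - t))"
    define v' where "v' = (\<lambda>p t. \<sigma> * u' (fst p) (snd p) t + K)"
    have diff: "\<sigma> * (u i n t - u j m t) = v (i, n) t - v (j, m) t" for i j n m t
      by (simp add: v_def algebra_simps)
    have "v (i, n) t \<le> 0"
    proof (rule backward_maximum_principle[OF S, where v = v and v' = v' and R = "B + \<eta> + G + G"])
      show "0 \<le> B + \<eta> + G + G" using B0 \<eta> by (simp add: G_def)
      show "(i, n) \<in> S" using i n by (auto simp: S_def)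
    next
      fix p t assume "p \<in> S" "t \<in> {0..T}"
      then show "(v p has_real_derivative v' p t) (at t within {0..T})"
        unfolding v_def v'_def S_def by (auto intro!: derivative_eq_intros u')
    next
      fix p assume "p \<in> S"
      then show "v p T \<le> 0"
        using \<sigma> \<psi>[of "fst p" "real (snd p) / real N"] frac[of "snd p"] uT[of "fst p" "snd p"]
        by (auto simp: S_def v_def abs_le_iff)
    next
      fix p t assume pt: "p \<in> S" "t \<in> {0..T}" "0 < v p t"
      obtain i n where p: "p = (i, n)" by (cases p)
      have in': "i \<in> {0, 1}" "n \<le> N" using pt p by (auto simp: S_def)
      define P where "P = (\<Sum>q\<in>S. max (v q t) 0)"
      have P0: "0 \<le> P" by (auto simp: P_def intro!: sum_nonneg)
      have P: "v (j, m) t - v (i, n) t \<le> P" if "j \<in> {0, 1}" "m \<le> N" for j m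
      proof -
        have "v (j, m) t \<le> max (v (j, m) t) 0" by simp
        also have "\<dots> \<le> P" unfolding P_def
          by (rule member_le_sum[of "(j, m)"]) (use S that in \<open>auto simp: S_def\<close>)
        finally show ?thesis using pt p by simp
      qed
      have rate: "r * (v (j, m) t - v (i, n) t) \<le> R * P"
        if "0 \<le> r" "r \<le> R" "j \<in> {0, 1}" "m \<le> N" for r R j m
        using mult_left_mono[OF P[of j m], of r] mult_right_mono[of r R P] P0 that by linarith
      have up': "gamma_up \<eta> N u i n t * (v (i, n + 1) t - v (i, n) t) \<le> G * P"
      proof (cases "n = N")
        case True
        then show ?thesis using B0 \<eta> P0 by (simp add: gamma_up_def G_def)
      next
        case False
        then show ?thesis using up[OF in' pt(2)] in' by (intro rate) auto
      qed
      have down': "gamma_down \<eta> u i n t * (v (i, n - 1) t - v (i, n) t) \<le> G * P"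
        using down[OF in' pt(2)] in' by (intro rate) auto
      have flip': "\<eta> * (v (1 - i, n) t - v (i, n) t) \<le> \<eta> * P"
        using in' \<eta> by (intro rate) auto
      \<comment> \<open>For \<sigma> = 1 the control cost has the good sign. For \<sigma> = -1 it
        equals half the control times a difference of values, so it acts like a jump to the other
        state at rate at most \<open>B\<close>.\<close>
      have quad: "- \<sigma> * (1/2 * (mpe_control u i n t)\<^sup>2) \<le> B * P"
      proof (cases "\<sigma> = 1")
        case True
        then have "- \<sigma> * (1/2 * (mpe_control u i n t)\<^sup>2) \<le> 0" by simp
        also have "0 \<le> B * P" using B0 P0 by simp
        finally show ?thesis .
      next
        case False
        with \<sigma> have \<sigma>: "\<sigma> = -1" by simp
        have "- \<sigma> * (1/2 * (mpe_control u i n t)\<^sup>2)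
            = 1/2 * mpe_control u i n t * (\<sigma> * (u (1 - i) n t - u i n t))"
          unfolding mpe_control_def by (simp add: \<sigma> max_def power2_eq_square)
        also have "\<dots> \<le> B * P"
          unfolding diff using \<alpha>[OF in' pt(2)] in' by (intro rate) auto
        finally show ?thesis .
      qed
      have "- v' p t = (\<sigma> * f i (real n / real N) - K) + (- \<sigma> * (1/2 * (mpe_control u i n t)\<^sup>2))
          + \<eta> * (\<sigma> * (u (1 - i) n t - u i n t))
          + gamma_up \<eta> N u i n t * (\<sigma> * (u i (n + 1) t - u i n t))
          + gamma_down \<eta> u i n t * (\<sigma> * (u i (n - 1) t - u i n t))"
        by (simp add: v'_def u'_def p algebra_simps)
      also have "\<dots> \<le> 0 + B * P + \<eta> * P + G * P + G * P"
      proof (intro add_mono quad)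
        show "\<sigma> * f i (real n / real N) - K \<le> 0"
          using \<sigma> f[of i "real n / real N"] frac[of n] in' by (auto simp: abs_le_iff)
      qed (use up' down' flip' in \<open>simp_all only: diff\<close>)
      finally show "- v' p t \<le> (B + \<eta> + G + G) * (\<Sum>q\<in>S. max (v q t) 0)"
        by (simp add: P_def[symmetric] algebra_simps)
    qed (rule t)
    then show ?thesis by (simp add: v_def)
  qed
  show ?thesis
    using main[of 1] main[of "-1"] by (simp add: abs_le_iff)
qed

section \<open>The law of the configurations\<close>

text \<open>\<open>\<bar>a\<bar> \<le> \<rho>/2 + a\<^sup>2/(2\<rho>)\<close> replaces the Cauchy--Schwarz inequality for the expectation.\<close>

lemma abs_le_half_square:
  fixes a \<rho> :: real
  assumes "0 < \<rho>"
  shows "\<bar>a\<bar> \<le> \<rho> / 2 + a\<^sup>2 / (2 * \<rho>)"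
  using zero_le_power2[of "\<bar>a\<bar> - \<rho>"] assms by (simp add: power2_eq_square field_simps)

text \<open>The probability space is replaced by the point masses \<mu> of the configuration at each
  time, so that expectations are finite sums. The bound \<open>C\<close> will be supplied
  independently of \<open>N\<close>.\<close>

locale equilibrium_law =
  fixes T \<eta> C :: real and f \<psi> :: "nat \<Rightarrow> real \<Rightarrow> real" and N :: nat
    and u :: "nat \<Rightarrow> nat \<Rightarrow> real \<Rightarrow> real" and \<mu> :: "real \<Rightarrow> (nat \<Rightarrow> nat) \<Rightarrow> real"
  assumes T_pos: "0 < T" and \<eta>_pos: "0 < \<eta>" and N_pos: "1 \<le> N"
    and u_value: "mpe_value T \<eta> f \<psi> N u"
    and u_diff: "\<And>i n t. i \<in> {0, 1} \<Longrightarrow> n \<le> N \<Longrightarrow> t \<in> {0..T} \<Longrightarrow> \<bar>u i n t - u (1 - i) n t\<bar> \<le> C"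
    and \<mu>_deriv: "\<And>y t. y \<in> configurations N \<Longrightarrow> t \<in> {0..T} \<Longrightarrow>
      ((\<lambda>r. \<mu> r y) has_real_derivative
        (\<Sum>z\<in>configurations N - {y}. \<mu> t z * configuration_rate \<eta> N (mpe_control u) t z y)
        - \<mu> t y * (\<Sum>z\<in>configurations N - {y}. configuration_rate \<eta> N (mpe_control u) t y z))
      (at t within {0..T})"
    and \<mu>_nonneg: "\<And>y t. y \<in> configurations N \<Longrightarrow> t \<in> {0..T} \<Longrightarrow> 0 \<le> \<mu> t y"
    and \<mu>_sum: "\<And>t. t \<in> {0..T} \<Longrightarrow> (\<Sum>y\<in>configurations N. \<mu> t y) = 1"
begin

section \<open>Expectations and averages over the players\<close>

definition expect :: "real \<Rightarrow> ((nat \<Rightarrow> nat) \<Rightarrow> real) \<Rightarrow> real" where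
  "expect t g = (\<Sum>x\<in>configurations N. \<mu> t x * g x)"

definition rate :: "real \<Rightarrow> nat \<Rightarrow> (nat \<Rightarrow> nat) \<Rightarrow> real" where
  "rate t k x = mpe_control u (x k) (num_zero_others N k x) t + \<eta>"

text \<open>The game starts from a deterministic configuration, so the players need not have the
  same law; averaging over all of them replaces the study of one typical player.\<close>

definition avg :: "(nat \<Rightarrow> real) \<Rightarrow> real" where
  "avg h = (\<Sum>k\<le>N. h k) / real (N + 1)"

definition fraction :: "(nat \<Rightarrow> nat) \<Rightarrow> real" where
  "fraction x = real (num_zero N x) / real (N + 1)"

lemma C_nonneg: "0 \<le> C"
  using u_diff[of 0 0 0] T_pos by auto

lemma expect_mono:
  assumes "t \<in> {0..T}" "\<And>x. x \<in> configurations N \<Longrightarrow> g x \<le> h x"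
  shows "expect t g \<le> expect t h"
  unfolding expect_def using assms \<mu>_nonneg by (intro sum_mono mult_left_mono) auto

lemma expect_const: "t \<in> {0..T} \<Longrightarrow> expect t (\<lambda>_. c) = c"
  by (simp add: expect_def sum_distrib_right[symmetric] \<mu>_sum)

lemma expect_add: "expect t (\<lambda>x. g x + h x) = expect t g + expect t h"
  by (simp add: expect_def algebra_simps sum.distrib)

lemma expect_diff: "expect t (\<lambda>x. g x - h x) = expect t g - expect t h"
  by (simp add: expect_def algebra_simps sum_subtractf)

lemma expect_cmult: "expect t (\<lambda>x. c * g x) = c * expect t g"
  by (simp add: expect_def sum_distrib_left mult_ac)

lemma expect_abs_le:
  assumes "t \<in> {0..T}" "\<And>x. x \<in> configurations N \<Longrightarrow> \<bar>g x\<bar> \<le> h x"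
  shows "\<bar>expect t g\<bar> \<le> expect t h"
proof -
  have "expect t g \<le> expect t h"
    by (rule expect_mono) (use assms in \<open>auto intro: abs_le_D1\<close>)
  moreover have "expect t (\<lambda>x. (-1) * g x) \<le> expect t h"
    by (rule expect_mono) (use assms in \<open>auto intro: abs_le_D2\<close>)
  ultimately show ?thesis
    unfolding expect_cmult by (simp add: abs_le_iff)
qed

lemma avg_mono: "(\<And>k. k \<le> N \<Longrightarrow> g k \<le> h k) \<Longrightarrow> avg g \<le> avg h"
  unfolding avg_def by (intro divide_right_mono sum_mono) auto

lemma avg_abs_le:
  assumes "\<And>k. k \<le> N \<Longrightarrow> \<bar>g k\<bar> \<le> h k" shows "\<bar>avg g\<bar> \<le> avg h"
proof -
  have "\<bar>avg g\<bar> = \<bar>\<Sum>k\<le>N. g k\<bar> / real (N + 1)" by (simp add: avg_def)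
  also have "\<dots> \<le> (\<Sum>k\<le>N. \<bar>g k\<bar>) / real (N + 1)"
    by (intro divide_right_mono sum_abs) auto
  also have "\<dots> \<le> avg h" unfolding avg_def
    by (intro divide_right_mono sum_mono) (use assms in auto)
  finally show ?thesis .
qed

lemma avg_const: "avg (\<lambda>_. c) = c"
  by (simp add: avg_def)

lemma avg_add: "avg (\<lambda>k. g k + h k) = avg g + avg h"
  by (simp add: avg_def sum.distrib add_divide_distrib)

lemma avg_diff: "avg (\<lambda>k. g k - h k) = avg g - avg h"
  by (simp add: avg_def sum_subtractf diff_divide_distrib)

lemma avg_cmult: "avg (\<lambda>k. c * g k) = c * avg g"
  by (simp add: avg_def sum_distrib_left)

lemma control_bounds:
  assumes "i \<in> {0, 1}" "n \<le> N" "t \<in> {0..T}"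
  shows "0 \<le> mpe_control u i n t" "mpe_control u i n t \<le> C"
  using u_diff[OF assms] C_nonneg by (auto simp: mpe_control_def)

lemma rate_bounds:
  assumes x: "x \<in> configurations N" and k: "k \<le> N" and t: "t \<in> {0..T}"
  shows "0 \<le> rate t k x" "rate t k x \<le> C + \<eta>"
proof -
  have "x k \<in> {0, 1}" using x k by (cases rule: configuration_cases) auto
  then show "0 \<le> rate t k x" "rate t k x \<le> C + \<eta>"
    using control_bounds[of "x k" "num_zero_others N k x" t] num_zero_others_le[OF k, of x] t \<eta>_pos
    by (auto simp: rate_def)
qed

lemma expect_deriv:
  assumes t: "t \<in> {0..T}"
    and \<phi>: "\<And>x. x \<in> configurations N \<Longrightarrow> (\<phi> x has_real_derivative \<phi>' x) (at t within {0..T})"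
  shows "((\<lambda>r. expect r (\<lambda>x. \<phi> x r)) has_real_derivative
      expect t (\<lambda>x. \<phi>' x + (\<Sum>k\<le>N. rate t k x * (\<phi> (flip k x) t - \<phi> x t)))) (at t within {0..T})"
proof -
  have "((\<lambda>r. \<Sum>x\<in>configurations N. \<mu> r x * \<phi> x r) has_real_derivative
      (\<Sum>x\<in>configurations N. \<mu> t x * (\<phi>' x + (\<Sum>z\<in>configurations N - {x}.
        configuration_rate \<eta> N (mpe_control u) t x z * (\<phi> z t - \<phi> x t))))) (at t within {0..T})"
    by (intro expectation_deriv finite_configurations \<mu>_deriv \<phi> t)
  also have "(\<Sum>x\<in>configurations N. \<mu> t x * (\<phi>' x + (\<Sum>z\<in>configurations N - {x}.
        configuration_rate \<eta> N (mpe_control u) t x z * (\<phi> z t - \<phi> x t)))) =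
      expect t (\<lambda>x. \<phi>' x + (\<Sum>k\<le>N. rate t k x * (\<phi> (flip k x) t - \<phi> x t)))"
    unfolding expect_def by (intro sum.cong refl) (simp add: configuration_rate_sum rate_def)
  finally show ?thesis
    unfolding expect_def .
qed

text \<open>The sign \<open>2 * x k - 1\<close> is the change of the number of players in state 0 when player \<open>k\<close>
  jumps.\<close>

lemma mean_deriv:
  assumes t: "t \<in> {0..T}"
  shows "((\<lambda>r. expect r fraction) has_real_derivative
      expect t (\<lambda>x. avg (\<lambda>k. rate t k x * (2 * real (x k) - 1)))) (at t within {0..T})"
proof -
  have "((\<lambda>r. expect r fraction) has_real_derivative
      expect t (\<lambda>x. 0 + (\<Sum>k\<le>N. rate t k x * (fraction (flip k x) - fraction x)))) (at t within {0..T})"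
    by (rule expect_deriv[OF t]) auto
  also have "expect t (\<lambda>x. 0 + (\<Sum>k\<le>N. rate t k x * (fraction (flip k x) - fraction x))) =
      expect t (\<lambda>x. avg (\<lambda>k. rate t k x * (2 * real (x k) - 1)))"
  proof -
    have "(\<Sum>k\<le>N. rate t k x * (fraction (flip k x) - fraction x)) =
        avg (\<lambda>k. rate t k x * (2 * real (x k) - 1))" if x: "x \<in> configurations N" for x
    proof -
      have "fraction (flip k x) - fraction x = (2 * real (x k) - 1) / real (N + 1)" if k: "k \<le> N" for k
        using x k
        by (cases rule: configuration_cases)
          (auto simp: fraction_def num_zero_flip[OF x k] num_zero_eq[OF x k] diff_divide_distrib[symmetric])
      then show ?thesis
        by (simp add: avg_def sum_divide_distrib)
    qed
    then show ?thesis
      unfolding expect_def by (intro sum.cong refl) simp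
  qed
  finally show ?thesis .
qed

text \<open>Each of the \<open>N + 1\<close> players jumps at rate at most \<open>C + \<eta>\<close>
  and moves the fraction by \<open>1 / (N + 1)\<close>. The bound is therefore uniform in
  \<open>N\<close> and passes to \<theta>.\<close>

lemma mean_lipschitz:
  assumes "0 \<le> s" "s \<le> t" "t \<le> T"
  shows "\<bar>expect t fraction - expect s fraction\<bar> \<le> (C + \<eta>) * (t - s)"
proof (rule abs_diff_le_if_deriv_bounded[OF mean_deriv _ assms])
  fix r assume r: "r \<in> {0..T}"
  have "\<bar>expect r (\<lambda>x. avg (\<lambda>k. rate r k x * (2 * real (x k) - 1)))\<bar> \<le> expect r (\<lambda>x. C + \<eta>)"
  proof (rule expect_abs_le[OF r])
    fix x assume x: "x \<in> configurations N"
    have "\<bar>avg (\<lambda>k. rate r k x * (2 * real (x k) - 1))\<bar> \<le> avg (\<lambda>_. C + \<eta>)"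
    proof (rule avg_abs_le)
      fix k assume k: "k \<le> N"
      from x k show "\<bar>rate r k x * (2 * real (x k) - 1)\<bar> \<le> C + \<eta>"
        by (cases rule: configuration_cases) (use rate_bounds[OF x k r] in auto)
    qed
    then show "\<bar>avg (\<lambda>k. rate r k x * (2 * real (x k) - 1))\<bar> \<le> C + \<eta>"
      by (simp add: avg_const)
  qed
  then show "\<bar>expect r (\<lambda>x. avg (\<lambda>k. rate r k x * (2 * real (x k) - 1)))\<bar> \<le> C + \<eta>"
    by (simp add: expect_const[OF r])
qed

lemma expect_abs_dev:
  assumes t: "t \<in> {0..T}" and \<rho>: "0 < \<rho>" and var: "expect t (\<lambda>x. (fraction x - c)\<^sup>2) \<le> \<rho>\<^sup>2"
  shows "expect t (\<lambda>x. \<bar>fraction x - c\<bar>) \<le> \<rho>"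
proof -
  have "expect t (\<lambda>x. \<bar>fraction x - c\<bar>) \<le> expect t (\<lambda>x. \<rho> / 2 + 1 / (2 * \<rho>) * (fraction x - c)\<^sup>2)"
    using abs_le_half_square[OF \<rho>] by (intro expect_mono[OF t]) (simp add: mult_ac)
  also have "\<dots> = \<rho> / 2 + 1 / (2 * \<rho>) * expect t (\<lambda>x. (fraction x - c)\<^sup>2)"
    by (simp only: expect_add expect_cmult expect_const[OF t])
  also have "\<dots> \<le> \<rho> / 2 + 1 / (2 * \<rho>) * \<rho>\<^sup>2"
    using \<rho> var by (intro add_left_mono mult_left_mono) auto
  also have "\<dots> = \<rho>" using \<rho> by (simp add: power2_eq_square)
  finally show ?thesis .
qed

lemma mean_dev:
  assumes t: "t \<in> {0..T}" and \<rho>: "0 < \<rho>" and var: "expect t (\<lambda>x. (fraction x - c)\<^sup>2) \<le> \<rho>\<^sup>2"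
  shows "\<bar>expect t fraction - c\<bar> \<le> \<rho>"
proof -
  have "\<bar>expect t fraction - c\<bar> = \<bar>expect t (\<lambda>x. fraction x - c)\<bar>"
    by (simp add: expect_diff expect_const[OF t])
  also have "\<dots> \<le> expect t (\<lambda>x. \<bar>fraction x - c\<bar>)"
    by (rule expect_abs_le[OF t]) simp
  finally show ?thesis using expect_abs_dev[OF assms] by linarith
qed

end

section \<open>Comparison with the Hamilton--Jacobi--Bellman equation\<close>

text \<open>The loss per squared own error in \<open>player_inequality\<close>. The summands come,
  in this order, from completing the square with the cost error \<delta>, from Young's inequality
  for the mixed products, from the jump of the player itself, and from the difference of the squared
  controls.\<close>

definition damping :: "real \<Rightarrow> real \<Rightarrow> real" where
  "damping \<eta> C = 1 + 2 * (C + \<eta>)\<^sup>2 / \<eta> + (C + \<eta>) + 2 * C"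

text \<open>Gronwall's factor over the time \<open>T\<close>, times a terminal error and a running
  error accumulated over \<open>T\<close>, each of size \<open>4 * L\<^sup>2\<close> in units of
  \<open>\<rho>\<^sup>2\<close>.\<close>

definition gap_const :: "real \<Rightarrow> real \<Rightarrow> real \<Rightarrow> real \<Rightarrow> real" where
  "gap_const T \<eta> C L = exp (damping \<eta> C * T) * (4 * L\<^sup>2 * (1 + T))"

text \<open>The coefficient of \<rho> in the comparison of the drifts: 1 from two uses of
  \<open>abs_le_half_square\<close>, the next summand from replacing the fraction by \<theta>, then
  the own error, and finally what remains when \<open>own_mean_drift_ge\<close> is solved for
  \<open>other_mean\<close>.\<close>

definition drift_const :: "real \<Rightarrow> real \<Rightarrow> real \<Rightarrow> real \<Rightarrow> real" where
  "drift_const T \<eta> C L = 1 + 2 * (C + \<eta>) + gap_const T \<eta> C L / 2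
    + (damping \<eta> C * gap_const T \<eta> C L + 4 * L\<^sup>2) / \<eta>"

lemma young_square:
  fixes a b c e :: real
  assumes "0 < e"
  shows "2 * c * \<bar>a\<bar> * \<bar>b\<bar> \<le> e / 2 * b\<^sup>2 + 2 * c\<^sup>2 / e * a\<^sup>2"
proof -
  have "0 \<le> (e * \<bar>b\<bar> - 2 * c * \<bar>a\<bar>)\<^sup>2 / (2 * e)"
    using assms by simp
  also have "\<dots> = e / 2 * b\<^sup>2 + 2 * c\<^sup>2 / e * a\<^sup>2 - 2 * c * \<bar>a\<bar> * \<bar>b\<bar>"
    using assms by (simp add: power2_diff power_mult_distrib) (simp add: power2_eq_square field_simps)
  finally show ?thesis by simp
qed

text \<open>\<open>d\<close> and \<open>d'\<close> are the errors \<open>u - v\<close> of a player in its own and in the other state, \<open>dp\<close> and \<open>dm\<close>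
  its errors after a jump of another player.  The jumps of the other players contribute the squares
  \<open>gp (dp - d)\<^sup>2\<close> and \<open>gm (dm - d)\<^sup>2\<close>; the jump rate of the player itself is at least \<open>\<eta> > 0\<close>,
  which yields control over the error in the state that is not occupied.\<close>

lemma player_inequality:
  fixes d d' dp dm gp gm \<delta> \<alpha> \<beta> \<eta> C :: real
  assumes \<eta>: "0 < \<eta>" and C: "0 \<le> C" and g: "0 \<le> gp" "0 \<le> gm"
    and \<alpha>: "0 \<le> \<alpha>" "\<alpha> \<le> C" and \<beta>: "0 \<le> \<beta>" "\<beta> \<le> C" and \<alpha>\<beta>: "\<bar>\<alpha> - \<beta>\<bar> \<le> \<bar>d - d'\<bar>"
  shows "- \<delta>\<^sup>2 + \<eta> / 2 * d'\<^sup>2 - damping \<eta> C * d\<^sup>2 \<le>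
    2 * d * (- \<delta> + 1/2 * (\<alpha>\<^sup>2 - \<beta>\<^sup>2) - \<eta> * (d' - d) - gp * (dp - d) - gm * (dm - d))
    + (\<alpha> + \<eta>) * (d'\<^sup>2 - d\<^sup>2) + gp * (dp\<^sup>2 - d\<^sup>2) + gm * (dm\<^sup>2 - d\<^sup>2)"
proof -
  have 1: "0 \<le> gp * (dp - d)\<^sup>2" "0 \<le> gm * (dm - d)\<^sup>2"
    using g by simp_all
  have 2: "- \<delta>\<^sup>2 - d\<^sup>2 \<le> - 2 * d * \<delta>"
    using zero_le_power2[of "d - \<delta>"] by (simp add: power2_diff)
  have 3: "- (2 * C * d\<^sup>2) - 2 * C * \<bar>d\<bar> * \<bar>d'\<bar> \<le> d * (\<alpha>\<^sup>2 - \<beta>\<^sup>2)"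
  proof -
    have "\<bar>d * (\<alpha>\<^sup>2 - \<beta>\<^sup>2)\<bar> = \<bar>d\<bar> * ((\<alpha> + \<beta>) * \<bar>\<alpha> - \<beta>\<bar>)"
    proof -
      have "\<alpha>\<^sup>2 - \<beta>\<^sup>2 = (\<alpha> + \<beta>) * (\<alpha> - \<beta>)" by (simp add: power2_eq_square algebra_simps)
      then show ?thesis using \<alpha> \<beta> by (simp add: abs_mult)
    qed
    also have "\<dots> \<le> \<bar>d\<bar> * ((C + C) * (\<bar>d\<bar> + \<bar>d'\<bar>))"
      using \<alpha> \<beta> \<alpha>\<beta> C by (intro mult_left_mono mult_mono) auto
    also have "\<dots> = 2 * C * d\<^sup>2 + 2 * C * \<bar>d\<bar> * \<bar>d'\<bar>"
      by (simp add: algebra_simps power2_eq_square)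
    finally show ?thesis by linarith
  qed
  have 4: "- (2 * \<eta> * \<bar>d\<bar> * \<bar>d'\<bar>) \<le> - (2 * \<eta> * (d * d'))"
    using \<eta> abs_ge_self[of "d * d'"] by (simp add: abs_mult)
  have 5: "\<eta> * d'\<^sup>2 - (C + \<eta>) * d\<^sup>2 \<le> (\<alpha> + \<eta>) * d'\<^sup>2 - (\<alpha> + \<eta>) * d\<^sup>2"
    using \<alpha> by (intro diff_mono mult_right_mono) auto
  \<comment> \<open>Half of the gain \<open>\<eta> * d'\<^sup>2\<close> pays for all mixed products,
    those from the controls and those from the noise; the other half stays in the
    conclusion.\<close>
  have 6: "2 * (C + \<eta>) * \<bar>d\<bar> * \<bar>d'\<bar> \<le> \<eta> / 2 * d'\<^sup>2 + 2 * (C + \<eta>)\<^sup>2 / \<eta> * d\<^sup>2"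
    by (rule young_square[OF \<eta>])
  have 7: "0 \<le> 2 * \<eta> * d\<^sup>2" using \<eta> by simp
  \<comment> \<open>The cancellation of the terms of order \<open>N\<close>:
    \<open>dp\<^sup>2 - d\<^sup>2 - 2 * d * (dp - d)\<close> is the square of \<open>dp - d\<close>,
    and likewise for \<open>dm\<close>.\<close>
  have "2 * d * (- \<delta> + 1/2 * (\<alpha>\<^sup>2 - \<beta>\<^sup>2) - \<eta> * (d' - d) - gp * (dp - d) - gm * (dm - d))
      + (\<alpha> + \<eta>) * (d'\<^sup>2 - d\<^sup>2) + gp * (dp\<^sup>2 - d\<^sup>2) + gm * (dm\<^sup>2 - d\<^sup>2)
    = - 2 * d * \<delta> + d * (\<alpha>\<^sup>2 - \<beta>\<^sup>2) - 2 * \<eta> * (d * d') + 2 * \<eta> * d\<^sup>2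
      + ((\<alpha> + \<eta>) * d'\<^sup>2 - (\<alpha> + \<eta>) * d\<^sup>2) + gp * (dp - d)\<^sup>2 + gm * (dm - d)\<^sup>2"
    by (simp add: power2_eq_square algebra_simps)
  moreover have "damping \<eta> C * d\<^sup>2 = d\<^sup>2 + 2 * (C + \<eta>)\<^sup>2 / \<eta> * d\<^sup>2 + (C + \<eta>) * d\<^sup>2 + 2 * C * d\<^sup>2"
    by (simp add: damping_def algebra_simps)
  moreover have "2 * (C + \<eta>) * \<bar>d\<bar> * \<bar>d'\<bar> = 2 * C * \<bar>d\<bar> * \<bar>d'\<bar> + 2 * \<eta> * \<bar>d\<bar> * \<bar>d'\<bar>"
    by (simp add: algebra_simps)
  moreover have "\<eta> * d'\<^sup>2 = \<eta> / 2 * d'\<^sup>2 + \<eta> / 2 * d'\<^sup>2" by simp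
  ultimately show ?thesis
    using 1 2 3 4 5 6 7 by linarith
qed

text \<open>The same \<rho> bounds the root mean square deviation of the fraction and the influence
  \<open>1 / (N + 1)\<close> of one player; the same \<open>C\<close> serves the game and the limit
  equation.\<close>

locale equilibrium_near_limit = equilibrium_law +
  fixes \<theta> :: "real \<Rightarrow> real" and v :: "nat \<Rightarrow> real \<Rightarrow> real" and L \<rho> :: real
  assumes f_lip: "\<And>i x y. i \<in> {0, 1} \<Longrightarrow> x \<in> {0..1} \<Longrightarrow> y \<in> {0..1} \<Longrightarrow> \<bar>f i x - f i y\<bar> \<le> L * \<bar>x - y\<bar>"
    and \<psi>_lip: "\<And>i x y. i \<in> {0, 1} \<Longrightarrow> x \<in> {0..1} \<Longrightarrow> y \<in> {0..1} \<Longrightarrow> \<bar>\<psi> i x - \<psi> i y\<bar> \<le> L * \<bar>x - y\<bar>"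
    and \<theta>_range: "\<And>t. t \<in> {0..T} \<Longrightarrow> \<theta> t \<in> {0..1}"
    and v_deriv: "\<And>i t. i \<in> {0, 1} \<Longrightarrow> t \<in> {0..T} \<Longrightarrow> (v i has_real_derivative
        - (f i (\<theta> t) - \<eta> * (v i t - v (1 - i) t) - 1/2 * (max (v i t - v (1 - i) t) 0)\<^sup>2))
        (at t within {0..T})"
    and v_terminal: "\<And>i. i \<in> {0, 1} \<Longrightarrow> v i T = \<psi> i (\<theta> T)"
    and v_diff: "\<And>i t. i \<in> {0, 1} \<Longrightarrow> t \<in> {0..T} \<Longrightarrow> \<bar>v i t - v (1 - i) t\<bar> \<le> C"
    and \<rho>_pos: "0 < \<rho>" and N_large: "1 / real (N + 1) \<le> \<rho>"
    and variance: "\<And>t. t \<in> {0..T} \<Longrightarrow> expect t (\<lambda>x. (fraction x - \<theta> t)\<^sup>2) \<le> \<rho>\<^sup>2"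
begin

definition err :: "nat \<Rightarrow> nat \<Rightarrow> real \<Rightarrow> real" where
  "err i n t = u i n t - v i t"

definition ctl :: "nat \<Rightarrow> real \<Rightarrow> real" where
  "ctl i t = max (v i t - v (1 - i) t) 0"

definition own :: "(nat \<Rightarrow> nat) \<Rightarrow> nat \<Rightarrow> real \<Rightarrow> real" where
  "own x k t = err (x k) (num_zero_others N k x) t"

text \<open>This is \<open>own\<close> after a jump of player \<open>k\<close> itself, because that
  jump does not change the number of zeros that \<open>k\<close> sees.\<close>

definition other :: "(nat \<Rightarrow> nat) \<Rightarrow> nat \<Rightarrow> real \<Rightarrow> real" where
  "other x k t = err (1 - x k) (num_zero_others N k x) t"

definition cost_gap :: "(nat \<Rightarrow> nat) \<Rightarrow> nat \<Rightarrow> real \<Rightarrow> real" where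
  "cost_gap x k t = f (x k) (real (num_zero_others N k x) / real N) - f (x k) (\<theta> t)"

definition own_mean :: "real \<Rightarrow> real" where
  "own_mean t = expect t (\<lambda>x. avg (\<lambda>k. (own x k t)\<^sup>2))"

definition other_mean :: "real \<Rightarrow> real" where
  "other_mean t = expect t (\<lambda>x. avg (\<lambda>k. (other x k t)\<^sup>2))"

text \<open>The difference of the equations for \<open>u\<close> and \<open>v\<close>. The
  differences of \<open>u\<close> in \<open>n\<close> can be written with \<open>err\<close>,
  because \<open>v\<close> does not depend on \<open>n\<close>.\<close>

definition err_drift :: "nat \<Rightarrow> nat \<Rightarrow> real \<Rightarrow> real" where
  "err_drift i n t = - (f i (real n / real N) - f i (\<theta> t))
     + 1/2 * ((mpe_control u i n t)\<^sup>2 - (ctl i t)\<^sup>2)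
     - \<eta> * (err (1 - i) n t - err i n t)
     - gamma_up \<eta> N u i n t * (err i (n + 1) t - err i n t)
     - gamma_down \<eta> u i n t * (err i (n - 1) t - err i n t)"

lemma err_deriv:
  assumes i: "i \<in> {0, 1}" and n: "n \<le> N" and t: "t \<in> {0..T}"
  shows "(err i n has_real_derivative err_drift i n t) (at t within {0..T})"
proof -
  have "(u i n has_real_derivative
              - (f i (real n / real N) - 1/2 * (mpe_control u i n t)\<^sup>2
                 + \<eta> * (u (1 - i) n t - u i n t)
                 + gamma_up \<eta> N u i n t * (u i (n + 1) t - u i n t)
                 + gamma_down \<eta> u i n t * (u i (n - 1) t - u i n t))) (at t within {0..T})"
    using u_value i n t unfolding mpe_value_def by blast
  then have "((\<lambda>t. u i n t - v i t) has_real_derivative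
      - (f i (real n / real N) - 1/2 * (mpe_control u i n t)\<^sup>2
                 + \<eta> * (u (1 - i) n t - u i n t)
                 + gamma_up \<eta> N u i n t * (u i (n + 1) t - u i n t)
                 + gamma_down \<eta> u i n t * (u i (n - 1) t - u i n t))
      - (- (f i (\<theta> t) - \<eta> * (v i t - v (1 - i) t) - 1/2 * (ctl i t)\<^sup>2))) (at t within {0..T})"
    unfolding ctl_def by (intro DERIV_diff v_deriv i t)
  moreover have "err i n = (\<lambda>t. u i n t - v i t)"
    by (simp add: err_def fun_eq_iff)
  ultimately show ?thesis
    by (simp add: err_drift_def err_def algebra_simps)
qed

lemma config_state: "x \<in> configurations N \<Longrightarrow> k \<le> N \<Longrightarrow> x k \<in> {0, 1}"
  by (erule (1) configuration_cases) auto

lemma gamma_nonneg: "0 \<le> gamma_up \<eta> N u i n t" "0 \<le> gamma_down \<eta> u i n t"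
  using \<eta>_pos by (auto simp: gamma_up_def gamma_down_def mpe_control_def)

lemma control_diff_le:
  "\<bar>mpe_control u i n t - ctl i t\<bar> \<le> \<bar>err i n t - err (1 - i) n t\<bar>"
  unfolding mpe_control_def ctl_def err_def by (auto simp: max_def)

lemma own_square_deriv:
  assumes x: "x \<in> configurations N" and k: "k \<le> N" and t: "t \<in> {0..T}"
  shows "((\<lambda>t. (own x k t)\<^sup>2) has_real_derivative
    2 * own x k t * err_drift (x k) (num_zero_others N k x) t) (at t within {0..T})"
  unfolding own_def
  using err_deriv[OF config_state[OF x k] num_zero_others_le[OF k] t]
  by (auto intro!: derivative_eq_intros)

text \<open>The generator splits into the jump of \<open>k\<close>, which exchanges
  \<open>own\<close> and \<open>other\<close>, and the jumps of the rest, which move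
  \<open>n\<close> by one at the rates of the equation for \<open>u\<close>. With these rates
  \<open>player_inequality\<close> applies.\<close>

lemma own_square_generator:
  assumes x: "x \<in> configurations N" and k: "k \<le> N" and t: "t \<in> {0..T}"
  shows "- (cost_gap x k t)\<^sup>2 + \<eta> / 2 * (other x k t)\<^sup>2 - damping \<eta> C * (own x k t)\<^sup>2 \<le>
    2 * own x k t * err_drift (x k) (num_zero_others N k x) t
    + (\<Sum>j\<le>N. rate t j x * ((own (flip j x) k t)\<^sup>2 - (own x k t)\<^sup>2))"
proof -
  define n where "n = num_zero_others N k x"
  define i where "i = x k"
  have i: "i \<in> {0, 1}" using config_state[OF x k] by (simp add: i_def)
  have n: "n \<le> N" using num_zero_others_le[OF k] by (simp add: n_def)
  have ii: "1 - (1 - i) = i" using i by auto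
  have flip_k: "flip k x k = 1 - x k"
    by (simp add: flip_def)
  have flip_j: "flip j x k = x k" if "j \<noteq> k" for j
    using that by (simp add: flip_def)
  have "(\<Sum>j\<le>N. rate t j x * ((own (flip j x) k t)\<^sup>2 - (own x k t)\<^sup>2)) =
      rate t k x * ((own (flip k x) k t)\<^sup>2 - (own x k t)\<^sup>2)
      + (\<Sum>j\<in>{..N} - {k}. rate t j x * ((own (flip j x) k t)\<^sup>2 - (own x k t)\<^sup>2))"
    using k by (intro sum.remove) auto
  also have "(\<Sum>j\<in>{..N} - {k}. rate t j x * ((own (flip j x) k t)\<^sup>2 - (own x k t)\<^sup>2)) =
      (\<Sum>j\<in>{..N} - {k}. (mpe_control u (x j) (num_zero_others N j x) t + \<eta>) *
        ((err i (num_zero_others N k (flip j x)) t)\<^sup>2 - (err i n t)\<^sup>2))"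
    by (intro sum.cong refl) (auto simp: rate_def flip_j own_def i_def n_def)
  also have "\<dots> = gamma_up \<eta> N u i n t * ((err i (n + 1) t)\<^sup>2 - (err i n t)\<^sup>2)
      + gamma_down \<eta> u i n t * ((err i (n - 1) t)\<^sup>2 - (err i n t)\<^sup>2)"
    unfolding n_def i_def by (rule other_players_generator[OF x k])
  finally have sum: "(\<Sum>j\<le>N. rate t j x * ((own (flip j x) k t)\<^sup>2 - (own x k t)\<^sup>2)) =
      (mpe_control u i n t + \<eta>) * ((err (1 - i) n t)\<^sup>2 - (err i n t)\<^sup>2)
      + (gamma_up \<eta> N u i n t * ((err i (n + 1) t)\<^sup>2 - (err i n t)\<^sup>2)
      + gamma_down \<eta> u i n t * ((err i (n - 1) t)\<^sup>2 - (err i n t)\<^sup>2))"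
    by (simp add: flip_k rate_def own_def other_def i_def n_def)
  have "ctl i t \<le> C" "0 \<le> ctl i t"
    using v_diff[OF i t] C_nonneg by (auto simp: ctl_def)
  then show ?thesis
    using player_inequality[OF \<eta>_pos C_nonneg gamma_nonneg[of i n t] control_bounds[OF i n t] _ _
      control_diff_le[of i n t], of "cost_gap x k t" "err i (n + 1) t" "err i (n - 1) t"]
    unfolding sum
    by (simp add: err_drift_def own_def other_def cost_gap_def i_def[symmetric] n_def[symmetric]
        add.assoc)
qed

text \<open>A player sees a fraction of \<open>N\<close> others, the process records a fraction of
  all \<open>N + 1\<close>. Including the player changes the fraction by at most
  \<open>1 / (N + 1)\<close>, hence by at most \<rho>; the factor 2 comes from squaring a
  sum.\<close>

lemma fraction_gap:
  assumes x: "x \<in> configurations N" and k: "k \<le> N" and c: "c \<in> {0..1}"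
  shows "(real (num_zero_others N k x) / real N - c)\<^sup>2 \<le> 2 * (\<rho>\<^sup>2 + (fraction x - c)\<^sup>2)"
proof -
  define n where "n = num_zero_others N k x"
  have n: "n \<le> N" using num_zero_others_le[OF k] by (simp add: n_def)
  define y where "y = real n / real N - fraction x"
  have y: "y = (real n - real N * (1 - real (x k))) / (real N * real (N + 1))"
    using x k
    by (cases rule: configuration_cases)
      (use N_pos in \<open>simp_all add: y_def fraction_def num_zero_eq[OF x k] n_def[symmetric] field_simps\<close>)
  have "\<bar>real n - real N * (1 - real (x k))\<bar> \<le> real N"
    using x k by (cases rule: configuration_cases) (use n in auto)
  then have "\<bar>y\<bar> \<le> real N / (real N * real (N + 1))"
    unfolding y abs_divide using N_pos by (intro divide_mono) auto
  also have "\<dots> \<le> \<rho>" using N_large N_pos by simp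
  finally have "y\<^sup>2 \<le> \<rho>\<^sup>2"
    using \<rho>_pos by (simp add: abs_le_square_iff[symmetric])
  moreover have "(real n / real N - c)\<^sup>2 = (y + (fraction x - c))\<^sup>2"
    by (simp add: y_def)
  moreover have "(a + b)\<^sup>2 \<le> 2 * (a\<^sup>2 + b\<^sup>2)" for a b :: real
    using sum_squares_bound[of a b] by (simp add: power2_sum)
  note this[of y "fraction x - c"]
  ultimately show ?thesis by (simp add: n_def)
qed

text \<open>The general \<open>h\<close> covers both the running cost in the drift of the error and
  the terminal cost in the error at time \<open>T\<close>.\<close>

lemma lipschitz_gap:
  assumes t: "t \<in> {0..T}"
    and h: "\<And>i x y. i \<in> {0, 1} \<Longrightarrow> x \<in> {0..1} \<Longrightarrow> y \<in> {0..1} \<Longrightarrow> \<bar>h i x - h i y\<bar> \<le> L * \<bar>x - y\<bar>"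
  shows "expect t (\<lambda>x. avg (\<lambda>k. (h (x k) (real (num_zero_others N k x) / real N) - h (x k) (\<theta> t))\<^sup>2))
    \<le> 4 * L\<^sup>2 * \<rho>\<^sup>2"
proof -
  have "expect t (\<lambda>x. avg (\<lambda>k. (h (x k) (real (num_zero_others N k x) / real N) - h (x k) (\<theta> t))\<^sup>2))
      \<le> expect t (\<lambda>x. 2 * L\<^sup>2 * \<rho>\<^sup>2 + 2 * L\<^sup>2 * (fraction x - \<theta> t)\<^sup>2)"
  proof (rule expect_mono[OF t])
    fix x assume x: "x \<in> configurations N"
    have "avg (\<lambda>k. (h (x k) (real (num_zero_others N k x) / real N) - h (x k) (\<theta> t))\<^sup>2)
        \<le> avg (\<lambda>k. 2 * L\<^sup>2 * \<rho>\<^sup>2 + 2 * L\<^sup>2 * (fraction x - \<theta> t)\<^sup>2)"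
    proof (rule avg_mono)
      fix k assume k: "k \<le> N"
      let ?y = "real (num_zero_others N k x) / real N"
      have "?y \<in> {0..1}"
        using num_zero_others_le[OF k, of x] N_pos by (simp add: divide_simps)
      then have "\<bar>h (x k) ?y - h (x k) (\<theta> t)\<bar> \<le> L * \<bar>?y - \<theta> t\<bar>"
        by (intro h config_state x k \<theta>_range t)
      then have "(h (x k) ?y - h (x k) (\<theta> t))\<^sup>2 \<le> (L * \<bar>?y - \<theta> t\<bar>)\<^sup>2"
        by (metis abs_ge_zero power2_abs power_mono)
      also have "\<dots> = L\<^sup>2 * (?y - \<theta> t)\<^sup>2" by (simp add: power_mult_distrib)
      also have "\<dots> \<le> L\<^sup>2 * (2 * (\<rho>\<^sup>2 + (fraction x - \<theta> t)\<^sup>2))"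
        by (intro mult_left_mono fraction_gap x k \<theta>_range t) auto
      finally show "(h (x k) ?y - h (x k) (\<theta> t))\<^sup>2 \<le> 2 * L\<^sup>2 * \<rho>\<^sup>2 + 2 * L\<^sup>2 * (fraction x - \<theta> t)\<^sup>2"
        by (simp add: algebra_simps)
    qed
    then show "avg (\<lambda>k. (h (x k) (real (num_zero_others N k x) / real N) - h (x k) (\<theta> t))\<^sup>2)
        \<le> 2 * L\<^sup>2 * \<rho>\<^sup>2 + 2 * L\<^sup>2 * (fraction x - \<theta> t)\<^sup>2"
      by (simp only: avg_const)
  qed
  also have "\<dots> = 2 * L\<^sup>2 * \<rho>\<^sup>2 + 2 * L\<^sup>2 * expect t (\<lambda>x. (fraction x - \<theta> t)\<^sup>2)"
    by (simp only: expect_add expect_cmult expect_const[OF t])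
  also have "\<dots> \<le> 2 * L\<^sup>2 * \<rho>\<^sup>2 + 2 * L\<^sup>2 * \<rho>\<^sup>2"
    by (intro add_left_mono mult_left_mono variance t) auto
  finally show ?thesis by simp
qed

section \<open>Evolution of the mean squared errors\<close>

definition own_mean_drift :: "real \<Rightarrow> real" where
  "own_mean_drift t = expect t (\<lambda>x. avg (\<lambda>k.
    2 * own x k t * err_drift (x k) (num_zero_others N k x) t
    + (\<Sum>j\<le>N. rate t j x * ((own (flip j x) k t)\<^sup>2 - (own x k t)\<^sup>2))))"

lemma own_mean_deriv:
  assumes t: "t \<in> {0..T}"
  shows "(own_mean has_real_derivative own_mean_drift t) (at t within {0..T})"
proof -
  have swap: "(\<Sum>j\<le>N. rate t j x * (avg (\<lambda>k. (own (flip j x) k t)\<^sup>2) - avg (\<lambda>k. (own x k t)\<^sup>2)))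
      = avg (\<lambda>k. \<Sum>j\<le>N. rate t j x * ((own (flip j x) k t)\<^sup>2 - (own x k t)\<^sup>2))" for x
    unfolding avg_def
    by (subst sum.swap[of _ "{..N}" "{..N}"])
      (simp add: sum_subtractf sum_distrib_left sum_divide_distrib diff_divide_distrib right_diff_distrib)
  have "((\<lambda>r. expect r (\<lambda>x. avg (\<lambda>k. (own x k r)\<^sup>2))) has_real_derivative
      expect t (\<lambda>x. avg (\<lambda>k. 2 * own x k t * err_drift (x k) (num_zero_others N k x) t)
        + (\<Sum>j\<le>N. rate t j x * (avg (\<lambda>k. (own (flip j x) k t)\<^sup>2) - avg (\<lambda>k. (own x k t)\<^sup>2)))))
      (at t within {0..T})"
  proof (rule expect_deriv[OF t])
    fix x assume "x \<in> configurations N"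
    then show "((\<lambda>r. avg (\<lambda>k. (own x k r)\<^sup>2)) has_real_derivative
        avg (\<lambda>k. 2 * own x k t * err_drift (x k) (num_zero_others N k x) t)) (at t within {0..T})"
      unfolding avg_def by (intro DERIV_cdivide DERIV_sum own_square_deriv t) auto
  qed
  then show ?thesis
    unfolding own_mean_def own_mean_drift_def swap avg_add .
qed

lemma own_mean_drift_ge:
  assumes t: "t \<in> {0..T}"
  shows "- (4 * L\<^sup>2 * \<rho>\<^sup>2) + \<eta> / 2 * other_mean t - damping \<eta> C * own_mean t \<le> own_mean_drift t"
proof -
  have "- (4 * L\<^sup>2 * \<rho>\<^sup>2) \<le> - expect t (\<lambda>x. avg (\<lambda>k. (cost_gap x k t)\<^sup>2))"
    using lipschitz_gap[OF t f_lip] unfolding cost_gap_def by simp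
  then have "- (4 * L\<^sup>2 * \<rho>\<^sup>2) + \<eta> / 2 * other_mean t - damping \<eta> C * own_mean t \<le>
      (-1) * expect t (\<lambda>x. avg (\<lambda>k. (cost_gap x k t)\<^sup>2)) + \<eta> / 2 * other_mean t
      - damping \<eta> C * own_mean t"
    by simp
  also have "\<dots> = expect t (\<lambda>x. avg (\<lambda>k. (-1) * (cost_gap x k t)\<^sup>2 + \<eta> / 2 * (other x k t)\<^sup>2
      - damping \<eta> C * (own x k t)\<^sup>2))"
    unfolding other_mean_def own_mean_def avg_add avg_diff avg_cmult expect_add expect_diff expect_cmult ..
  also have "\<dots> \<le> own_mean_drift t"
    unfolding own_mean_drift_def
    by (intro expect_mono[OF t] avg_mono) (use own_square_generator t in auto)
  finally show ?thesis .
qed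

lemma own_mean_nonneg: "t \<in> {0..T} \<Longrightarrow> 0 \<le> own_mean t"
  unfolding own_mean_def expect_def avg_def
  by (intro sum_nonneg mult_nonneg_nonneg divide_nonneg_nonneg \<mu>_nonneg) auto

lemma other_mean_nonneg: "t \<in> {0..T} \<Longrightarrow> 0 \<le> other_mean t"
  unfolding other_mean_def expect_def avg_def
  by (intro sum_nonneg mult_nonneg_nonneg divide_nonneg_nonneg \<mu>_nonneg) auto

lemma damping_nonneg: "0 \<le> damping \<eta> C"
  using \<eta>_pos C_nonneg by (auto simp: damping_def)

lemma own_mean_terminal: "own_mean T \<le> 4 * L\<^sup>2 * \<rho>\<^sup>2"
proof -
  have T: "T \<in> {0..T}" using T_pos by simp
  have "own x k T = \<psi> (x k) (real (num_zero_others N k x) / real N) - \<psi> (x k) (\<theta> T)"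
    if "x \<in> configurations N" "k \<le> N" for x k
    using u_value v_terminal[OF config_state[OF that]] config_state[OF that]
      num_zero_others_le[OF that(2), of x]
    unfolding mpe_value_def own_def err_def by auto
  then have "own_mean T = expect T (\<lambda>x. avg (\<lambda>k.
      (\<psi> (x k) (real (num_zero_others N k x) / real N) - \<psi> (x k) (\<theta> T))\<^sup>2))"
    unfolding own_mean_def expect_def avg_def by (intro sum.cong refl) simp
  also have "\<dots> \<le> 4 * L\<^sup>2 * \<rho>\<^sup>2" by (rule lipschitz_gap[OF T \<psi>_lip])
  finally show ?thesis .
qed

text \<open>Gronwall's argument backwards from \<open>T\<close>. Here \<open>other_mean\<close>
  contributes only its sign; its size is exploited in \<open>mean_increment_close\<close>.\<close>

lemma own_mean_le:
  assumes t: "t \<in> {0..T}"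
  shows "own_mean t \<le> gap_const T \<eta> C L * \<rho>\<^sup>2"
proof -
  define k where "k = damping \<eta> C"
  have k: "0 \<le> k" using damping_nonneg by (simp add: k_def)
  define c where "c = exp (k * T) * (4 * L\<^sup>2 * \<rho>\<^sup>2)"
  have "exp (k * t) * own_mean t + c * t \<le> exp (k * T) * own_mean T + c * T"
  proof (rule mono_on_interval_if_deriv_nonneg[where g = "\<lambda>t. exp (k * t) * own_mean t + c * t"])
    fix r assume r: "r \<in> {0..T}"
    show "((\<lambda>t. exp (k * t) * own_mean t + c * t) has_real_derivative
        exp (k * r) * (own_mean_drift r + k * own_mean r) + c) (at r within {0..T})"
      by (auto intro!: derivative_eq_intros own_mean_deriv[OF r] simp: algebra_simps)
    have "0 \<le> \<eta> / 2 * other_mean r" using \<eta>_pos other_mean_nonneg[OF r] by simp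
    then have "- (4 * L\<^sup>2 * \<rho>\<^sup>2) \<le> own_mean_drift r + k * own_mean r"
      using own_mean_drift_ge[OF r] by (simp add: k_def)
    then have "exp (k * r) * - (4 * L\<^sup>2 * \<rho>\<^sup>2) \<le> exp (k * r) * (own_mean_drift r + k * own_mean r)"
      by (intro mult_left_mono) auto
    moreover have "exp (k * r) * (4 * L\<^sup>2 * \<rho>\<^sup>2) \<le> c"
      unfolding c_def using k r by (intro mult_right_mono) (auto intro: mult_left_mono)
    ultimately show "0 \<le> exp (k * r) * (own_mean_drift r + k * own_mean r) + c"
      by simp
  qed (use t in auto)
  moreover have "exp (k * T) * own_mean T \<le> c"
    unfolding c_def by (intro mult_left_mono own_mean_terminal) auto
  moreover have "0 \<le> c * t" using t by (simp add: c_def)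
  moreover have "own_mean t \<le> exp (k * t) * own_mean t"
  proof -
    have "1 \<le> exp (k * t)" using k t by simp
    then show ?thesis using mult_right_mono[of 1 "exp (k * t)" "own_mean t"] own_mean_nonneg[OF t] by simp
  qed
  ultimately have "own_mean t \<le> c + c * T" by linarith
  also have "\<dots> = gap_const T \<eta> C L * \<rho>\<^sup>2"
    by (simp add: gap_const_def c_def k_def algebra_simps)
  finally show ?thesis .
qed

section \<open>Comparison of the drift of the mean fraction with the limit equation\<close>

definition limit_drift :: "real \<Rightarrow> real" where
  "limit_drift t = (1 - \<theta> t) * (ctl 1 t + \<eta>) - \<theta> t * (ctl 0 t + \<eta>)"

lemma avg_limit_rate:
  assumes x: "x \<in> configurations N"
  shows "avg (\<lambda>k. (ctl (x k) t + \<eta>) * (2 * real (x k) - 1)) =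
    (1 - fraction x) * (ctl 1 t + \<eta>) - fraction x * (ctl 0 t + \<eta>)"
proof -
  define Z where "Z = {k\<in>{..N}. x k = 0}"
  have Z: "Z \<subseteq> {..N}" "card Z = num_zero N x"
    by (auto simp: Z_def num_zero_def)
  then have le: "num_zero N x \<le> N + 1"
    by (metis card_atMost card_mono finite_atMost Suc_eq_plus1)
  have "card ({..N} - Z) = N + 1 - num_zero N x"
    using Z by (subst card_Diff_subset) (auto intro: finite_subset)
  then have card: "real (card ({..N} - Z)) = real (N + 1) - real (num_zero N x)"
    using le by (simp add: of_nat_diff)
  let ?h = "\<lambda>k. (ctl (x k) t + \<eta>) * (2 * real (x k) - 1)"
  have "(\<Sum>k\<in>{..N} - Z. ?h k) = (\<Sum>k\<in>{..N} - Z. ctl 1 t + \<eta>)"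
    using x by (intro sum.cong refl) (auto simp: Z_def elim: configuration_cases)
  moreover have "(\<Sum>k\<in>Z. ?h k) = (\<Sum>k\<in>Z. - (ctl 0 t + \<eta>))"
    by (intro sum.cong refl) (auto simp: Z_def)
  moreover have "real (num_zero N x) * - (ctl 0 t + \<eta>) = - (real (num_zero N x) * (ctl 0 t + \<eta>))"
    by (rule mult_minus_right)
  ultimately have "(\<Sum>k\<le>N. ?h k) = (real (N + 1) - real (num_zero N x)) * (ctl 1 t + \<eta>)
      - real (num_zero N x) * (ctl 0 t + \<eta>)"
    using sum.subset_diff[OF Z(1), of ?h] Z(2) card by (simp only: sum_constant) simp
  moreover have "real (num_zero N x) = fraction x * real (N + 1)"
    by (simp add: fraction_def)
  ultimately have "(\<Sum>k\<le>N. ?h k) =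
      ((1 - fraction x) * (ctl 1 t + \<eta>) - fraction x * (ctl 0 t + \<eta>)) * real (N + 1)"
    by (simp only: algebra_simps mult_1)
  then show ?thesis by (simp add: avg_def)
qed

text \<open>Two replacements are made. Passing to the limit controls costs at most the own plus the
  other error of each player, since positive parts are 1-Lipschitz; passing from the fraction to
  \<theta> costs its mean absolute deviation.\<close>

lemma mean_drift_close:
  assumes t: "t \<in> {0..T}"
  shows "\<bar>expect t (\<lambda>x. avg (\<lambda>k. rate t k x * (2 * real (x k) - 1))) - limit_drift t\<bar>
    \<le> \<rho> + (own_mean t + other_mean t) / (2 * \<rho>) + 2 * (C + \<eta>) * \<rho>"
proof -
  have ctl: "0 \<le> ctl i t" "ctl i t \<le> C" if "i \<in> {0, 1}" for i
    using v_diff[OF that t] C_nonneg by (auto simp: ctl_def)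
  have "\<bar>expect t (\<lambda>x. avg (\<lambda>k. rate t k x * (2 * real (x k) - 1))) - limit_drift t\<bar> =
      \<bar>expect t (\<lambda>x. avg (\<lambda>k. rate t k x * (2 * real (x k) - 1)) - limit_drift t)\<bar>"
    by (simp only: expect_diff expect_const[OF t])
  also have "\<dots> \<le> expect t (\<lambda>x. avg (\<lambda>k. \<rho> + 1 / (2 * \<rho>) * ((own x k t)\<^sup>2 + (other x k t)\<^sup>2))
      + 2 * (C + \<eta>) * \<bar>fraction x - \<theta> t\<bar>)"
  proof (rule expect_abs_le[OF t])
    fix x assume x: "x \<in> configurations N"
    have "\<bar>avg (\<lambda>k. rate t k x * (2 * real (x k) - 1)) -
        avg (\<lambda>k. (ctl (x k) t + \<eta>) * (2 * real (x k) - 1))\<bar> \<le>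
        avg (\<lambda>k. \<rho> + 1 / (2 * \<rho>) * ((own x k t)\<^sup>2 + (other x k t)\<^sup>2))"
      unfolding avg_diff[symmetric]
    proof (rule avg_abs_le)
      fix k assume k: "k \<le> N"
      have "\<bar>rate t k x * (2 * real (x k) - 1) - (ctl (x k) t + \<eta>) * (2 * real (x k) - 1)\<bar>
          = \<bar>mpe_control u (x k) (num_zero_others N k x) t - ctl (x k) t\<bar>"
        using x k by (cases rule: configuration_cases) (auto simp: rate_def)
      also have "\<dots> \<le> \<bar>own x k t - other x k t\<bar>"
        using control_diff_le by (simp add: own_def other_def)
      also have "\<dots> \<le> \<bar>own x k t\<bar> + \<bar>other x k t\<bar>" by (rule abs_triangle_ineq4)
      also have "\<dots> \<le> (\<rho> / 2 + (own x k t)\<^sup>2 / (2 * \<rho>)) + (\<rho> / 2 + (other x k t)\<^sup>2 / (2 * \<rho>))"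
        by (intro add_mono abs_le_half_square \<rho>_pos)
      also have "\<dots> = \<rho> + 1 / (2 * \<rho>) * ((own x k t)\<^sup>2 + (other x k t)\<^sup>2)"
        by (simp add: algebra_simps add_divide_distrib)
      finally show "\<bar>rate t k x * (2 * real (x k) - 1) - (ctl (x k) t + \<eta>) * (2 * real (x k) - 1)\<bar>
          \<le> \<rho> + 1 / (2 * \<rho>) * ((own x k t)\<^sup>2 + (other x k t)\<^sup>2)" .
    qed
    moreover have "\<bar>avg (\<lambda>k. (ctl (x k) t + \<eta>) * (2 * real (x k) - 1)) - limit_drift t\<bar>
        \<le> 2 * (C + \<eta>) * \<bar>fraction x - \<theta> t\<bar>"
    proof -
      have "avg (\<lambda>k. (ctl (x k) t + \<eta>) * (2 * real (x k) - 1)) - limit_drift t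
          = - ((ctl 1 t + ctl 0 t + 2 * \<eta>) * (fraction x - \<theta> t))"
        unfolding avg_limit_rate[OF x] limit_drift_def by (simp add: algebra_simps)
      then have "\<bar>avg (\<lambda>k. (ctl (x k) t + \<eta>) * (2 * real (x k) - 1)) - limit_drift t\<bar>
          = (ctl 1 t + ctl 0 t + 2 * \<eta>) * \<bar>fraction x - \<theta> t\<bar>"
        using ctl[of 0] ctl[of 1] \<eta>_pos by (simp add: abs_mult)
      also have "\<dots> \<le> (2 * (C + \<eta>)) * \<bar>fraction x - \<theta> t\<bar>"
        using ctl[of 0] ctl[of 1] by (intro mult_right_mono) auto
      finally show ?thesis .
    qed
    ultimately show "\<bar>avg (\<lambda>k. rate t k x * (2 * real (x k) - 1)) - limit_drift t\<bar> \<le>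
        avg (\<lambda>k. \<rho> + 1 / (2 * \<rho>) * ((own x k t)\<^sup>2 + (other x k t)\<^sup>2))
        + 2 * (C + \<eta>) * \<bar>fraction x - \<theta> t\<bar>"
      by linarith
  qed
  also have "\<dots> = \<rho> + 1 / (2 * \<rho>) * (own_mean t + other_mean t)
      + 2 * (C + \<eta>) * expect t (\<lambda>x. \<bar>fraction x - \<theta> t\<bar>)"
    by (simp only: avg_add avg_cmult avg_const expect_add expect_cmult expect_const[OF t]
        own_mean_def other_mean_def)
  also have "\<dots> \<le> \<rho> + 1 / (2 * \<rho>) * (own_mean t + other_mean t) + 2 * (C + \<eta>) * \<rho>"
    using C_nonneg \<eta>_pos by (intro add_left_mono mult_left_mono expect_abs_dev t \<rho>_pos variance) auto
  finally show ?thesis by simp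
qed

text \<open>There is no pointwise bound on \<open>other_mean\<close>, but
  \<open>own_mean_drift_ge\<close> bounds it by the derivative of \<open>own_mean\<close> up to
  terms of order \<open>\<rho>\<^sup>2\<close>. Hence \<open>own_mean r / (\<eta> * \<rho>)\<close>,
  with a linear term added, compensates the difference of the drifts, and monotonicity takes the
  place of an integral of \<open>other_mean\<close>. The summand with \<open>gap_const\<close> is
  the terminal size of the compensator.\<close>

lemma mean_increment_close:
  assumes antideriv: "\<And>r. r \<in> {0..T} \<Longrightarrow> (B has_real_derivative
        (1 - \<theta> r) * (max (v 1 r - v 0 r) 0 + \<eta>) - \<theta> r * (max (v 0 r - v 1 r) 0 + \<eta>))
        (at r within {0..T})"
    and t: "t \<in> {0..T}"
  shows "\<bar>(expect t fraction - expect 0 fraction) - (B t - B 0)\<bar>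
    \<le> (drift_const T \<eta> C L * T + gap_const T \<eta> C L / \<eta>) * \<rho>"
proof -
  have B: "(B has_real_derivative limit_drift r) (at r within {0..T})" if "r \<in> {0..T}" for r
    using antideriv[OF that] by (simp add: limit_drift_def ctl_def)
  define c where "c = drift_const T \<eta> C L"
  define \<kappa> where "\<kappa> = gap_const T \<eta> C L"
  have \<kappa>: "0 \<le> \<kappa>" using T_pos by (simp add: \<kappa>_def gap_const_def)
  have c: "0 \<le> c"
    using \<kappa> C_nonneg \<eta>_pos damping_nonneg by (simp add: c_def drift_const_def \<kappa>_def[symmetric])
  let ?d = "\<lambda>r. expect r (\<lambda>x. avg (\<lambda>k. rate r k x * (2 * real (x k) - 1)))"
  have close: "\<bar>?d r - limit_drift r\<bar> \<le> c * \<rho> + own_mean_drift r / (\<eta> * \<rho>)" if r: "r \<in> {0..T}" for r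
  proof -
    have "other_mean r \<le> 2 / \<eta> * (own_mean_drift r + damping \<eta> C * own_mean r + 4 * L\<^sup>2 * \<rho>\<^sup>2)"
      using own_mean_drift_ge[OF r] \<eta>_pos by (simp add: field_simps)
    also have "\<dots> \<le> 2 / \<eta> * (own_mean_drift r + damping \<eta> C * (\<kappa> * \<rho>\<^sup>2) + 4 * L\<^sup>2 * \<rho>\<^sup>2)"
      unfolding \<kappa>_def using \<eta>_pos
      by (intro mult_left_mono add_mono order_refl own_mean_le[OF r] damping_nonneg) auto
    finally have "own_mean r + other_mean r \<le> \<kappa> * \<rho>\<^sup>2 +
        2 / \<eta> * (own_mean_drift r + damping \<eta> C * (\<kappa> * \<rho>\<^sup>2) + 4 * L\<^sup>2 * \<rho>\<^sup>2)"
      using own_mean_le[OF r] by (simp add: \<kappa>_def)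
    then have "(own_mean r + other_mean r) / (2 * \<rho>) \<le> (\<kappa> * \<rho>\<^sup>2 +
        2 / \<eta> * (own_mean_drift r + damping \<eta> C * (\<kappa> * \<rho>\<^sup>2) + 4 * L\<^sup>2 * \<rho>\<^sup>2)) / (2 * \<rho>)"
      using \<rho>_pos by (intro divide_right_mono) auto
    also have "\<dots> = own_mean_drift r / (\<eta> * \<rho>)
        + (\<kappa> / 2 + (damping \<eta> C * \<kappa> + 4 * L\<^sup>2) / \<eta>) * \<rho>"
      using \<rho>_pos \<eta>_pos by (simp add: field_simps power2_eq_square)
    finally have "\<bar>?d r - limit_drift r\<bar> \<le> \<rho> + (own_mean_drift r / (\<eta> * \<rho>)
        + (\<kappa> / 2 + (damping \<eta> C * \<kappa> + 4 * L\<^sup>2) / \<eta>) * \<rho>) + 2 * (C + \<eta>) * \<rho>"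
      using mean_drift_close[OF r] by linarith
    also have "\<dots> = c * \<rho> + own_mean_drift r / (\<eta> * \<rho>)"
      by (simp add: c_def drift_const_def \<kappa>_def[symmetric] algebra_simps)
    finally show ?thesis .
  qed
  have main: "\<sigma> * ((expect t fraction - expect 0 fraction) - (B t - B 0)) \<le> (c * T + \<kappa> / \<eta>) * \<rho>"
    if \<sigma>: "\<sigma> = 1 \<or> \<sigma> = -1" for \<sigma> :: real
  proof -
    let ?g = "\<lambda>r. c * \<rho> * r + own_mean r / (\<eta> * \<rho>) - \<sigma> * (expect r fraction - B r)"
    have "?g 0 \<le> ?g t"
    proof (rule mono_on_interval_if_deriv_nonneg[where g = ?g])
      fix r assume r: "r \<in> {0..T}"
      show "(?g has_real_derivative c * \<rho> + own_mean_drift r / (\<eta> * \<rho>) - \<sigma> * (?d r - limit_drift r))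
          (at r within {0..T})"
        by (intro DERIV_diff DERIV_add DERIV_cmult DERIV_cdivide mean_deriv own_mean_deriv B r)
          (auto intro!: derivative_eq_intros)
      show "0 \<le> c * \<rho> + own_mean_drift r / (\<eta> * \<rho>) - \<sigma> * (?d r - limit_drift r)"
        using close[OF r] \<sigma> by (auto simp: abs_le_iff)
    qed (use t in auto)
    moreover have "own_mean t / (\<eta> * \<rho>) \<le> \<kappa> * \<rho>\<^sup>2 / (\<eta> * \<rho>)"
      using \<eta>_pos \<rho>_pos own_mean_le[OF t] by (intro divide_right_mono) (auto simp: \<kappa>_def)
    moreover have "\<kappa> * \<rho>\<^sup>2 / (\<eta> * \<rho>) = \<kappa> / \<eta> * \<rho>"
      using \<rho>_pos by (simp add: power2_eq_square)
    moreover have "0 \<le> own_mean 0 / (\<eta> * \<rho>)"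
      using \<eta>_pos \<rho>_pos own_mean_nonneg[of 0] T_pos by simp
    moreover have "c * \<rho> * t \<le> c * \<rho> * T"
      using c \<rho>_pos t by (intro mult_left_mono) auto
    ultimately show ?thesis by (simp add: algebra_simps)
  qed
  show ?thesis
    using main[of 1] main[of "-1"] by (simp add: abs_le_iff c_def \<kappa>_def)
qed

end

section \<open>Fluid limits\<close>

text \<open>The Markov property is used at time 0 with the whole space as past event. Since the
  start is almost surely \<open>x\<^sub>0\<close>, the row of the transition function at
  \<open>x\<^sub>0\<close> is the law, and it inherits the forward equation.\<close>

lemma law_of_process:
  assumes X: "markov_jump_process T S q M X" and S: "finite S" and x\<^sub>0: "x\<^sub>0 \<in> S"
    and init: "AE \<omega> in M. X 0 \<omega> = x\<^sub>0" and T: "0 \<le> T"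
  obtains \<mu> where
    "\<And>y t. y \<in> S \<Longrightarrow> t \<in> {0..T} \<Longrightarrow> ((\<lambda>r. \<mu> r y) has_real_derivative
        (\<Sum>z\<in>S - {y}. \<mu> t z * q t z y) - \<mu> t y * (\<Sum>z\<in>S - {y}. q t y z)) (at t within {0..T})"
    "\<And>y t. y \<in> S \<Longrightarrow> t \<in> {0..T} \<Longrightarrow> \<mu> t y = measure M {\<omega>\<in>space M. X t \<omega> = y}"
proof -
  interpret prob_space M using X by (simp add: markov_jump_process_def)
  have meas: "X t \<in> M \<rightarrow>\<^sub>M count_space S" if "t \<in> {0..T}" for t
    using X that by (simp add: markov_jump_process_def)
  obtain p where p: "transition_function T S q p"
    and markov: "\<And>s t A x y. 0 \<le> s \<Longrightarrow> s \<le> t \<Longrightarrow> t \<le> T \<Longrightarrow> A \<in> past_events M S X s \<Longrightarrow>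
      x \<in> S \<Longrightarrow> y \<in> S \<Longrightarrow> measure M {\<omega>\<in>A. X s \<omega> = x \<and> X t \<omega> = y} =
              measure M {\<omega>\<in>A. X s \<omega> = x} * p s t x y"
    using X unfolding markov_jump_process_def by blast
  have ev: "{\<omega>\<in>space M. X t \<omega> = y} \<in> sets M" if "t \<in> {0..T}" "y \<in> S" for t y
    using measurable_sets[OF meas[OF that(1)], of "{y}"] that
    by (simp add: vimage_def Int_def conj_commute)
  show ?thesis
  proof (rule that[of "\<lambda>t y. p 0 t x\<^sub>0 y"])
    fix y t assume yt: "y \<in> S" "t \<in> {0..T}"
    then show "((\<lambda>r. p 0 r x\<^sub>0 y) has_real_derivative (\<Sum>z\<in>S - {y}. p 0 t x\<^sub>0 z * q t z y)
        - p 0 t x\<^sub>0 y * (\<Sum>z\<in>S - {y}. q t y z)) (at t within {0..T})"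
      using p x\<^sub>0 T unfolding transition_function_def by auto
    have "space M \<in> past_events M S X 0"
      unfolding past_events_def by (rule sigma_sets_top)
    then have "measure M {\<omega>\<in>space M. X 0 \<omega> = x\<^sub>0 \<and> X t \<omega> = y} =
        measure M {\<omega>\<in>space M. X 0 \<omega> = x\<^sub>0} * p 0 t x\<^sub>0 y"
      using yt x\<^sub>0 by (intro markov) auto
    moreover have "measure M {\<omega>\<in>space M. X 0 \<omega> = x\<^sub>0} = 1"
      using prob_Collect_eq_1[of "\<lambda>\<omega>. X 0 \<omega> = x\<^sub>0"] ev[of 0 x\<^sub>0] T x\<^sub>0 init by simp
    moreover have "{\<omega>\<in>space M. X 0 \<omega> = x\<^sub>0 \<and> X t \<omega> = y} =
        {\<omega>\<in>space M. X 0 \<omega> = x\<^sub>0} \<inter> {\<omega>\<in>space M. X t \<omega> = y}" by auto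
    then have "measure M {\<omega>\<in>space M. X 0 \<omega> = x\<^sub>0 \<and> X t \<omega> = y} = measure M {\<omega>\<in>space M. X t \<omega> = y}"
      using ev[of 0 x\<^sub>0] ev[of t y] yt T x\<^sub>0 init
      by (intro measure_eq_AE) auto
    ultimately show "p 0 t x\<^sub>0 y = measure M {\<omega>\<in>space M. X t \<omega> = y}" by simp
  qed
qed

lemma (in prob_space) sum_point_probabilities:
  assumes X: "X \<in> M \<rightarrow>\<^sub>M count_space S" and S: "finite S" and A: "A \<subseteq> S"
  shows "(\<Sum>y\<in>A. measure M {\<omega>\<in>space M. X \<omega> = y}) = measure M {\<omega>\<in>space M. X \<omega> \<in> A}"
proof -
  have "{\<omega>\<in>space M. X \<omega> = y} \<in> sets M" if "y \<in> A" for y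
    using measurable_sets[OF X, of "{y}"] that A
    by (auto simp: vimage_def Int_def conj_commute)
  then have "measure M (\<Union>y\<in>A. {\<omega>\<in>space M. X \<omega> = y}) = (\<Sum>y\<in>A. measure M {\<omega>\<in>space M. X \<omega> = y})"
    using A S by (intro finite_measure_finite_Union) (auto simp: disjoint_family_on_def intro: finite_subset)
  moreover have "(\<Union>y\<in>A. {\<omega>\<in>space M. X \<omega> = y}) = {\<omega>\<in>space M. X \<omega> \<in> A}" by auto
  ultimately show ?thesis by simp
qed

text \<open>Since \<open>measure\<close> vanishes outside \<open>sets M\<close>, an event of positive measure is measurable.\<close>

lemma (in prob_space) expectation_square_le:
  assumes X: "X \<in> M \<rightarrow>\<^sub>M count_space S" and S: "finite S"
    and \<mu>: "\<And>y. y \<in> S \<Longrightarrow> \<mu> y = measure M {\<omega>\<in>space M. X \<omega> = y}"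
    and E: "\<And>\<omega>. \<omega> \<in> E \<Longrightarrow> \<omega> \<in> space M \<and> \<bar>g (X \<omega>)\<bar> < e" and pE: "1 - e\<^sup>2 < measure M E"
    and e: "0 < e" "e < 1" and g: "\<And>y. y \<in> S \<Longrightarrow> \<bar>g y\<bar> \<le> 1"
  shows "(\<Sum>y\<in>S. \<mu> y * (g y)\<^sup>2) \<le> 2 * e\<^sup>2"
proof -
  have "e\<^sup>2 < 1" using e by (simp add: power_less_one_iff abs_square_less_1)
  then have "measure M E \<noteq> 0" using pE by linarith
  then have EM: "E \<in> sets M" by (metis measure_notin_sets)
  define G where "G = {y\<in>S. \<bar>g y\<bar> < e}"
  have XS: "X \<omega> \<in> S" if "\<omega> \<in> space M" for \<omega>
    using measurable_space[OF X that] by simp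
  have "measure M E \<le> measure M {\<omega>\<in>space M. X \<omega> \<in> G}"
  proof (rule finite_measure_mono)
    show "E \<subseteq> {\<omega>\<in>space M. X \<omega> \<in> G}"
      using E XS by (auto simp: G_def)
    show "{\<omega>\<in>space M. X \<omega> \<in> G} \<in> sets M"
      using measurable_sets[OF X, of G] by (auto simp: G_def vimage_def Int_def conj_commute)
  qed
  also have "\<dots> = (\<Sum>y\<in>G. measure M {\<omega>\<in>space M. X \<omega> = y})"
    by (rule sum_point_probabilities[OF X S, symmetric]) (auto simp: G_def)
  also have "\<dots> = (\<Sum>y\<in>G. \<mu> y)"
    using \<mu> by (intro sum.cong refl) (auto simp: G_def)
  finally have G: "1 - e\<^sup>2 \<le> (\<Sum>y\<in>G. \<mu> y)" using pE by linarith
  have "(\<Sum>y\<in>S. \<mu> y) = measure M {\<omega>\<in>space M. X \<omega> \<in> S}"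
    using sum_point_probabilities[OF X S order_refl] \<mu> by simp
  also have "{\<omega>\<in>space M. X \<omega> \<in> S} = space M" using XS by auto
  finally have sum1: "(\<Sum>y\<in>S. \<mu> y) = 1" by (simp add: prob_space)
  have nn: "0 \<le> \<mu> y" if "y \<in> S" for y using \<mu>[OF that] by simp
  have GS: "G \<subseteq> S" by (auto simp: G_def)
  have "(\<Sum>y\<in>S. \<mu> y * (g y)\<^sup>2) = (\<Sum>y\<in>S - G. \<mu> y * (g y)\<^sup>2) + (\<Sum>y\<in>G. \<mu> y * (g y)\<^sup>2)"
    by (rule sum.subset_diff[OF GS S])
  also have "\<dots> \<le> (\<Sum>y\<in>S - G. \<mu> y * 1) + (\<Sum>y\<in>G. \<mu> y * e\<^sup>2)"
  proof (intro add_mono sum_mono mult_left_mono)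
    show "(g y)\<^sup>2 \<le> 1" if "y \<in> S - G" for y
      using g[of y] that by (simp add: abs_square_le_1)
    show "(g y)\<^sup>2 \<le> e\<^sup>2" if "y \<in> G" for y
      using that e by (simp add: G_def abs_le_square_iff[symmetric])
  qed (use nn GS in auto)
  also have "\<dots> = ((\<Sum>y\<in>S. \<mu> y) - (\<Sum>y\<in>G. \<mu> y)) + (\<Sum>y\<in>G. \<mu> y) * e\<^sup>2"
    using sum.subset_diff[OF GS S, of \<mu>] by (simp add: sum_distrib_right)
  also have "\<dots> \<le> e\<^sup>2 + 1 * e\<^sup>2"
  proof (intro add_mono mult_right_mono)
    have "(\<Sum>y\<in>G. \<mu> y) \<le> (\<Sum>y\<in>S. \<mu> y)"
      by (rule sum_mono2[OF S GS]) (use nn in auto)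
    then show "(\<Sum>y\<in>G. \<mu> y) \<le> 1" using sum1 by simp
  qed (use G sum1 in auto)
  finally show ?thesis by simp
qed

lemma num_zero_fraction_range:
  "real (num_zero N x) / real (N + 1) \<in> {0..1}"
proof -
  have "num_zero N x \<le> card {..N}"
    unfolding num_zero_def by (rule card_mono) auto
  then show ?thesis by (simp add: divide_simps)
qed

text \<open>If \<theta> left the unit interval by a distance \<open>d\<close>, the events for
  \<epsilon> = \<open>d\<close> would all be empty, and their probabilities could not tend to
  1.\<close>

lemma FLMP_trajectory_range:
  fixes M :: "nat \<Rightarrow> 'w measure"
  assumes lim: "\<And>\<epsilon>. \<epsilon> > 0 \<Longrightarrow> (\<lambda>N. measure (M N) {\<omega>\<in>space (M N). \<forall>t\<in>{0..T}.
      \<bar>real (num_zero N (X N t \<omega>)) / real (N + 1) - \<theta> t\<bar> < \<epsilon>}) \<longlonglongrightarrow> 1"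
    and t: "t \<in> {0..T}"
  shows "\<theta> t \<in> {0..1}"
proof (rule ccontr)
  assume notin: "\<theta> t \<notin> {0..1}"
  define d where "d = max (\<theta> t - 1) (- \<theta> t)"
  have pos: "d > 0" using notin by (auto simp: d_def)
  have "\<not> \<bar>y - \<theta> t\<bar> < d" if "y \<in> {0..1}" for y
    using that by (auto simp: d_def)
  then have "{\<omega>\<in>space (M N). \<forall>t\<in>{0..T}.
      \<bar>real (num_zero N (X N t \<omega>)) / real (N + 1) - \<theta> t\<bar> < d} = {}" for N
    using t num_zero_fraction_range by blast
  then have "(\<lambda>N. 0 :: real) \<longlonglongrightarrow> 1"
    using lim[OF pos] by (simp only: measure_empty)
  then show False
    using LIMSEQ_unique tendsto_const zero_neq_one by blast
qed


text \<open>This performs the passage to the limit \<rho> to 0 once each scale has been given its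
  own game.\<close>

lemma le_if_le_plus_multiple:
  fixes a b c :: real
  assumes "0 \<le> c" and le: "\<And>e. 0 < e \<Longrightarrow> e < 1 \<Longrightarrow> a \<le> b + c * e"
  shows "a \<le> b"
proof (rule field_le_epsilon)
  fix d :: real assume d: "0 < d"
  define e where "e = min (1/2) (d / (c + 1))"
  have "a \<le> b + c * e" using assms d by (intro le) (auto simp: e_def)
  also have "c * e \<le> c * (d / (c + 1))"
    using assms(1) by (intro mult_left_mono) (auto simp: e_def)
  also have "\<dots> \<le> d" using assms(1) d by (simp add: field_simps)
  finally show "a \<le> b + d" by simp
qed

lemma admissible_cost_bounded:
  assumes "admissible_cost g"
  obtains K where "\<And>i x. i \<in> {0, 1} \<Longrightarrow> x \<in> {0..1} \<Longrightarrow> \<bar>g i x\<bar> \<le> K"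
proof -
  have "bounded (g 0 ` {0..1} \<union> g 1 ` {0..1})"
    using assms by (simp add: admissible_cost_def)
  then obtain K where "\<And>y. y \<in> g 0 ` {0..1} \<union> g 1 ` {0..1} \<Longrightarrow> \<bar>y\<bar> \<le> K"
    unfolding bounded_iff by auto
  then show ?thesis by (intro that[of K]) auto
qed

lemma admissible_cost_lipschitz:
  assumes "admissible_cost g"
  obtains L where "\<And>i x y. i \<in> {0, 1} \<Longrightarrow> x \<in> {0..1} \<Longrightarrow> y \<in> {0..1} \<Longrightarrow> \<bar>g i x - g i y\<bar> \<le> L * \<bar>x - y\<bar>"
proof -
  obtain L where L: "\<And>i. i \<in> {0, 1} \<Longrightarrow> L-lipschitz_on {0..1} (g i)"
    using assms unfolding admissible_cost_def by blast
  show ?thesis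
    by (rule that[of L]) (use lipschitz_onD[OF L] in \<open>auto simp: dist_real_def\<close>)
qed

theorem proposition1:
  fixes T \<eta> :: real and f \<psi> :: "nat \<Rightarrow> real \<Rightarrow> real" and \<theta> :: "real \<Rightarrow> real"
  assumes "T > 0" and "\<eta> > 0"
    and "admissible_cost f" and "admissible_cost \<psi>"
    and "FLMP_trajectory TYPE('w) T \<eta> f \<psi> \<theta>"
  shows "mfg_nash_equilibrium T \<eta> f \<psi> (\<theta> 0) \<theta>"
proof -
  note T = assms(1) and \<eta> = assms(2)
  obtain x\<^sub>0 and M :: "nat \<Rightarrow> 'w measure" and X where
    proc: "\<And>N. N \<ge> 1 \<Longrightarrow> mpe_process T \<eta> f \<psi> N (x\<^sub>0 N) (M N) (X N)" and
    lim: "\<And>\<epsilon>. \<epsilon> > 0 \<Longrightarrow> (\<lambda>N. measure (M N) {\<omega>\<in>space (M N). \<forall>t\<in>{0..T}.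
              \<bar>real (num_zero N (X N t \<omega>)) / real (N + 1) - \<theta> t\<bar> < \<epsilon>}) \<longlonglongrightarrow> 1"
    using assms(5) unfolding FLMP_trajectory_def by blast
  have \<theta>: "\<theta> t \<in> {0..1}" if "t \<in> {0..T}" for t
    by (rule FLMP_trajectory_range[OF lim that])
  obtain Kf where Kf: "\<And>i x. i \<in> {0, 1} \<Longrightarrow> x \<in> {0..1} \<Longrightarrow> \<bar>f i x\<bar> \<le> Kf"
    using admissible_cost_bounded[OF assms(3)] by blast
  obtain K\<psi> where K\<psi>: "\<And>i x. i \<in> {0, 1} \<Longrightarrow> x \<in> {0..1} \<Longrightarrow> \<bar>\<psi> i x\<bar> \<le> K\<psi>"
    using admissible_cost_bounded[OF assms(4)] by blast
  define K where "K = max Kf K\<psi>"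
  have K: "\<bar>f i x\<bar> \<le> K" "\<bar>\<psi> i x\<bar> \<le> K" if "i \<in> {0, 1}" "x \<in> {0..1}" for i x
    using Kf[OF that] K\<psi>[OF that] by (auto simp: K_def)
  have K0: "0 \<le> K" using K(1)[of 0 0] by simp
  define C\<^sub>0 where "C\<^sub>0 = 2 * (K + K * T)"
  obtain Lf where Lf: "\<And>i x y. i \<in> {0, 1} \<Longrightarrow> x \<in> {0..1} \<Longrightarrow> y \<in> {0..1} \<Longrightarrow> \<bar>f i x - f i y\<bar> \<le> Lf * \<bar>x - y\<bar>"
    using admissible_cost_lipschitz[OF assms(3)] by blast
  obtain L\<psi> where L\<psi>: "\<And>i x y. i \<in> {0, 1} \<Longrightarrow> x \<in> {0..1} \<Longrightarrow> y \<in> {0..1} \<Longrightarrow> \<bar>\<psi> i x - \<psi> i y\<bar> \<le> L\<psi> * \<bar>x - y\<bar>"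
    using admissible_cost_lipschitz[OF assms(4)] by blast
  define L where "L = max Lf L\<psi>"
  have L: "\<bar>f i x - f i y\<bar> \<le> L * \<bar>x - y\<bar>" "\<bar>\<psi> i x - \<psi> i y\<bar> \<le> L * \<bar>x - y\<bar>"
    if "i \<in> {0, 1}" "x \<in> {0..1}" "y \<in> {0..1}" for i x y
    using Lf[OF that] L\<psi>[OF that] mult_right_mono[of Lf L "\<bar>x - y\<bar>"] mult_right_mono[of L\<psi> L "\<bar>x - y\<bar>"]
    by (auto simp: L_def)

  \<comment> \<open>Convergence in probability enters only here. It becomes, for every scale, the
    existence of one sufficiently large game whose law is close to \<theta> in mean square at all
    times.\<close>
  have game: "\<exists>N u \<mu>. 1 / real (N + 1) \<le> \<rho> \<and> equilibrium_law T \<eta> C\<^sub>0 f \<psi> N u \<mu> \<and>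
      (\<forall>t\<in>{0..T}. equilibrium_law.expect N \<mu> t (\<lambda>x. (equilibrium_law.fraction N x - \<theta> t)\<^sup>2) \<le> \<rho>\<^sup>2)"
    if \<rho>: "0 < \<rho>" "\<rho> < 1" for \<rho>
  proof -
    \<comment> \<open>\<open>expectation_square_le\<close> will give \<open>2 * e\<^sup>2\<close>:
      an exceptional event of probability below \<open>e\<^sup>2\<close> and a deviation below
      \<open>e\<close> outside it.\<close>
    define e where "e = \<rho> / 2"
    have e: "0 < e" "e < 1" "2 * e\<^sup>2 \<le> \<rho>\<^sup>2" using \<rho> by (auto simp: e_def power2_eq_square)
    define E where "E = (\<lambda>N. {\<omega>\<in>space (M N). \<forall>t\<in>{0..T}.
              \<bar>real (num_zero N (X N t \<omega>)) / real (N + 1) - \<theta> t\<bar> < e})"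
    have "\<forall>\<^sub>F N in sequentially. 1 - e\<^sup>2 < measure (M N) (E N)"
      unfolding E_def by (rule order_tendstoD(1)[OF lim]) (use e in auto)
    moreover have "(\<lambda>N. 1 / real (Suc N)) \<longlonglongrightarrow> 0"
      using LIMSEQ_inverse_real_of_nat by (simp add: inverse_eq_divide)
    then have "\<forall>\<^sub>F N in sequentially. 1 / real (Suc N) < \<rho>"
      by (rule order_tendstoD(2)) (use \<rho> in auto)
    ultimately have "\<forall>\<^sub>F N in sequentially. 1 - e\<^sup>2 < measure (M N) (E N) \<and> 1 / real (Suc N) < \<rho> \<and> N \<ge> 1"
      using eventually_ge_at_top[of 1] by eventually_elim auto
    then obtain N where N: "1 - e\<^sup>2 < measure (M N) (E N)" "1 / real (N + 1) < \<rho>" "N \<ge> 1"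
      by (auto simp: eventually_at_top_linorder)
    obtain u where u: "mpe_value T \<eta> f \<psi> N u"
      and X: "markov_jump_process T (configurations N) (configuration_rate \<eta> N (mpe_control u)) (M N) (X N)"
      and x\<^sub>0: "x\<^sub>0 N \<in> configurations N" "AE \<omega> in M N. X N 0 \<omega> = x\<^sub>0 N"
      using proc[OF N(3)] unfolding mpe_process_def by blast
    interpret prob_space "M N" using X by (simp add: markov_jump_process_def)
    have meas: "X N t \<in> M N \<rightarrow>\<^sub>M count_space (configurations N)" if "t \<in> {0..T}" for t
      using X that by (simp add: markov_jump_process_def)
    obtain \<mu> where \<mu>:
      "\<And>y t. y \<in> configurations N \<Longrightarrow> t \<in> {0..T} \<Longrightarrow> ((\<lambda>r. \<mu> r y) has_real_derivative
        (\<Sum>z\<in>configurations N - {y}. \<mu> t z * configuration_rate \<eta> N (mpe_control u) t z y)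
        - \<mu> t y * (\<Sum>z\<in>configurations N - {y}. configuration_rate \<eta> N (mpe_control u) t y z))
        (at t within {0..T})"
      "\<And>y t. y \<in> configurations N \<Longrightarrow> t \<in> {0..T} \<Longrightarrow>
        \<mu> t y = measure (M N) {\<omega>\<in>space (M N). X N t \<omega> = y}"
      by (rule law_of_process[OF X finite_configurations x\<^sub>0 less_imp_le[OF T]]) (rule that)
    have u_bound: "\<bar>u i n t\<bar> \<le> K + K * T" if "i \<in> {0, 1}" "n \<le> N" "t \<in> {0..T}" for i n t
    proof -
      have "\<bar>u i n t\<bar> \<le> K + K * (T - t)"
        by (rule mpe_value_bounded[OF u N(3) less_imp_le[OF \<eta>] K that])
      also have "\<dots> \<le> K + K * T"
        using K0 that by (intro add_left_mono mult_left_mono) auto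
      finally show ?thesis .
    qed
    have u_diff: "\<bar>u i n t - u (1 - i) n t\<bar> \<le> C\<^sub>0" if "i \<in> {0, 1}" "n \<le> N" "t \<in> {0..T}" for i n t
    proof -
      have "1 - i \<in> {0, 1}" using that by auto
      then show ?thesis
        using u_bound[OF that] u_bound[OF \<open>1 - i \<in> {0, 1}\<close> that(2,3)]
          abs_triangle_ineq4[of "u i n t" "u (1 - i) n t"]
        by (simp add: C\<^sub>0_def)
    qed
    have sum1: "(\<Sum>y\<in>configurations N. \<mu> t y) = 1" if t: "t \<in> {0..T}" for t
    proof -
      have "(\<Sum>y\<in>configurations N. \<mu> t y) = measure (M N) {\<omega>\<in>space (M N). X N t \<omega> \<in> configurations N}"
        using sum_point_probabilities[OF meas[OF t] finite_configurations order_refl] \<mu>(2)[OF _ t] by simp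
      also have "{\<omega>\<in>space (M N). X N t \<omega> \<in> configurations N} = space (M N)"
        using measurable_space[OF meas[OF t]] by auto
      finally show ?thesis by (simp add: prob_space)
    qed
    interpret equilibrium_law T \<eta> C\<^sub>0 f \<psi> N u \<mu>
      by unfold_locales (use T \<eta> N u u_diff \<mu> sum1 in auto)
    have "expect t (\<lambda>x. (fraction x - \<theta> t)\<^sup>2) \<le> \<rho>\<^sup>2" if t: "t \<in> {0..T}" for t
    proof -
      have "expect t (\<lambda>x. (fraction x - \<theta> t)\<^sup>2) \<le> 2 * e\<^sup>2"
        unfolding expect_def
      proof (rule expectation_square_le[OF meas[OF t] finite_configurations \<mu>(2)[OF _ t] _ N(1) e(1,2)])
        show "\<omega> \<in> space (M N) \<and> \<bar>fraction (X N t \<omega>) - \<theta> t\<bar> < e" if "\<omega> \<in> E N" for \<omega>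
          using that t unfolding E_def fraction_def by blast
        have "fraction y \<in> {0..1}" for y
          unfolding fraction_def by (rule num_zero_fraction_range)
        then show "\<bar>fraction y - \<theta> t\<bar> \<le> 1" for y
          using \<theta>[OF t] by (smt (verit) atLeastAtMost_iff)
      qed
      then show ?thesis using e by linarith
    qed
    then show ?thesis
      using N(2) equilibrium_law_axioms by (intro exI[of _ N] exI[of _ u] exI[of _ \<mu>]) auto
  qed

  have C\<^sub>0: "0 \<le> C\<^sub>0" using K0 T by (simp add: C\<^sub>0_def)
  \<comment> \<open>Regularity of \<theta> is not part of its definition, but continuity is required
    before the equation for \<open>v\<close> can be solved. It comes from the means, at the cost of
    one \<rho> at each end point.\<close>
  have \<theta>_lip: "\<bar>\<theta> t - \<theta> s\<bar> \<le> (C\<^sub>0 + \<eta>) * (t - s)" if st: "0 \<le> s" "s \<le> t" "t \<le> T" for s t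
  proof (rule le_if_le_plus_multiple)
    fix \<rho> :: real assume \<rho>: "0 < \<rho>" "\<rho> < 1"
    obtain N u \<mu> where g: "equilibrium_law T \<eta> C\<^sub>0 f \<psi> N u \<mu>"
      and var: "\<And>t. t \<in> {0..T} \<Longrightarrow>
        equilibrium_law.expect N \<mu> t (\<lambda>x. (equilibrium_law.fraction N x - \<theta> t)\<^sup>2) \<le> \<rho>\<^sup>2"
      using game[OF \<rho>] by blast
    interpret equilibrium_law T \<eta> C\<^sub>0 f \<psi> N u \<mu> by (rule g)
    have "s \<in> {0..T}" "t \<in> {0..T}" using st by auto
    then show "\<bar>\<theta> t - \<theta> s\<bar> \<le> (C\<^sub>0 + \<eta>) * (t - s) + 2 * \<rho>"
      using mean_lipschitz[OF st] mean_dev[OF \<open>s \<in> {0..T}\<close> \<rho>(1) var] mean_dev[OF \<open>t \<in> {0..T}\<close> \<rho>(1) var]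
      by linarith
  qed simp
  have "(C\<^sub>0 + \<eta>)-lipschitz_on {0..T} \<theta>"
  proof (rule lipschitz_onI)
    fix s t assume "s \<in> {0..T}" "t \<in> {0..T}"
    then show "dist (\<theta> s) (\<theta> t) \<le> (C\<^sub>0 + \<eta>) * dist s t"
      using \<theta>_lip[of s t] \<theta>_lip[of t s] by (cases "s \<le> t") (auto simp: dist_real_def abs_minus_commute)
  qed (use C\<^sub>0 \<eta> in simp)
  then have \<theta>_cont: "continuous_on {0..T} \<theta>" by (rule lipschitz_on_continuous_on)
  have "continuous_on {0..T} (\<lambda>t. f i (\<theta> t))" if "i \<in> {0, 1}" for i
  proof (rule continuous_on_compose2[OF _ \<theta>_cont])
    show "continuous_on {0..1} (f i)"
      using assms(3) that unfolding admissible_cost_def by (auto intro: lipschitz_on_continuous_on)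
  qed (use \<theta> in auto)
  then obtain v0 v1 where v: "v0 T = \<psi> 0 (\<theta> T)" "v1 T = \<psi> 1 (\<theta> T)"
    "\<And>t. t \<in> {0..T} \<Longrightarrow> (v0 has_real_derivative
        - (f 0 (\<theta> t) - \<eta> * (v0 t - v1 t) - 1/2 * (max (v0 t - v1 t) 0)\<^sup>2)) (at t within {0..T})"
    "\<And>t. t \<in> {0..T} \<Longrightarrow> (v1 has_real_derivative
        - (f 1 (\<theta> t) - \<eta> * (v1 t - v0 t) - 1/2 * (max (v1 t - v0 t) 0)\<^sup>2)) (at t within {0..T})"
    using HJB_solution_exists[of T "\<lambda>t. f 0 (\<theta> t)" "\<lambda>t. f 1 (\<theta> t)" \<eta> "\<psi> 0 (\<theta> T)" "\<psi> 1 (\<theta> T)"] T \<eta>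
    by auto
  define w where "w = (\<lambda>i::nat. if i = 0 then v0 else v1)"
  have w_deriv: "(w i has_real_derivative
      - (f i (\<theta> t) - \<eta> * (w i t - w (1 - i) t) - 1/2 * (max (w i t - w (1 - i) t) 0)\<^sup>2))
      (at t within {0..T})" if "i \<in> {0, 1}" "t \<in> {0..T}" for i t
    using that v(3,4)[OF that(2)] by (auto simp: w_def)
  have w_T: "w i T = \<psi> i (\<theta> T)" if "i \<in> {0, 1}" for i
    using that v(1,2) by (auto simp: w_def)
  have w_cont: "continuous_on {0..T} (w i)" if "i \<in> {0, 1}" for i
    using w_deriv[OF that] by (rule DERIV_continuous_on)
  have "continuous_on {0..T} (\<lambda>t. w 0 t - w 1 t)"
    by (intro continuous_intros w_cont) auto
  then have "bounded ((\<lambda>t. w 0 t - w 1 t) ` {0..T})"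
    by (intro compact_imp_bounded compact_continuous_image) auto
  then obtain C\<^sub>1 where C\<^sub>1: "\<And>t. t \<in> {0..T} \<Longrightarrow> \<bar>w 0 t - w 1 t\<bar> \<le> C\<^sub>1"
    unfolding bounded_iff by (metis imageI real_norm_def)
  \<comment> \<open>One bound for the game values and for the limit values. The second is determined
    by \<theta> and the costs, so the maximum is again independent of \<open>N\<close>.\<close>
  define C where "C = max C\<^sub>0 C\<^sub>1"
  have w_diff: "\<bar>w i t - w (1 - i) t\<bar> \<le> C" if "i \<in> {0, 1}" "t \<in> {0..T}" for i t
    using that C\<^sub>1[OF that(2)] by (auto simp: C_def abs_minus_commute)
  define b where "b = (\<lambda>t. (1 - \<theta> t) * (max (w 1 t - w 0 t) 0 + \<eta>) - \<theta> t * (max (w 0 t - w 1 t) 0 + \<eta>))"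
  have "continuous_on {0..T} b"
    unfolding b_def by (intro continuous_intros \<theta>_cont w_cont) auto
  then have B: "((\<lambda>t. integral {0..t} b) has_real_derivative b t) (at t within {0..T})"
    if "t \<in> {0..T}" for t
    by (rule integral_has_real_derivative[OF _ that])
  define B where "B = (\<lambda>t. integral {0..t} b)"
  note B = B[folded B_def]
  define c where "c = drift_const T \<eta> C L * T + gap_const T \<eta> C L / \<eta>"
  have c: "0 \<le> c"
    using C\<^sub>0 T \<eta> unfolding c_def drift_const_def gap_const_def damping_def C_def by (simp add: le_max_iff_disj)
  \<comment> \<open>The limit equation is proved in integrated form, which survives \<rho> to 0;
    differentiation follows afterwards. The error is \<open>c * \<rho>\<close> for the increment of
    the mean and one \<rho> for the mean at each of the times 0 and \<open>t\<close>.\<close>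
  have "\<bar>\<theta> t - (\<theta> 0 + (B t - B 0))\<bar> \<le> 0" if t: "t \<in> {0..T}" for t
  proof (rule le_if_le_plus_multiple)
    fix \<rho> :: real assume \<rho>: "0 < \<rho>" "\<rho> < 1"
    obtain N u \<mu> where N: "1 / real (N + 1) \<le> \<rho>" and g: "equilibrium_law T \<eta> C\<^sub>0 f \<psi> N u \<mu>"
      and var: "\<And>t. t \<in> {0..T} \<Longrightarrow>
        equilibrium_law.expect N \<mu> t (\<lambda>x. (equilibrium_law.fraction N x - \<theta> t)\<^sup>2) \<le> \<rho>\<^sup>2"
      using game[OF \<rho>] by blast
    interpret equilibrium_law T \<eta> C\<^sub>0 f \<psi> N u \<mu> by (rule g)
    interpret near: equilibrium_near_limit T \<eta> C f \<psi> N u \<mu> \<theta> w L \<rho>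
    proof unfold_locales
      show "\<bar>u i n t - u (1 - i) n t\<bar> \<le> C" if "i \<in> {0, 1}" "n \<le> N" "t \<in> {0..T}" for i n t
        using u_diff[OF that] by (simp add: C_def)
    qed (use T_pos \<eta>_pos N_pos u_value \<mu>_deriv \<mu>_nonneg \<mu>_sum L \<theta> w_deriv w_T w_diff \<rho> N var in auto)
    have "0 \<in> {0..T}" using T by simp
    have "\<bar>(expect t fraction - expect 0 fraction) - (B t - B 0)\<bar> \<le> c * \<rho>"
      unfolding c_def by (rule near.mean_increment_close[OF _ t]) (use B in \<open>simp add: b_def\<close>)
    moreover have "\<bar>expect 0 fraction - \<theta> 0\<bar> \<le> \<rho>" "\<bar>expect t fraction - \<theta> t\<bar> \<le> \<rho>"
      using mean_dev[OF _ \<rho>(1) var] t \<open>0 \<in> {0..T}\<close> by blast+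
    ultimately have "\<bar>\<theta> t - (\<theta> 0 + (B t - B 0))\<bar> \<le> c * \<rho> + 2 * \<rho>"
      by linarith
    then show "\<bar>\<theta> t - (\<theta> 0 + (B t - B 0))\<bar> \<le> 0 + (c + 2) * \<rho>"
      by (simp add: algebra_simps)
  qed (use c in simp)
  then have \<theta>_eq: "\<theta> t = \<theta> 0 + (B t - B 0)" if "t \<in> {0..T}" for t
    by (metis abs_le_zero_iff eq_iff_diff_eq_0 that)
  have "(\<theta> has_real_derivative b t) (at t within {0..T})" if t: "t \<in> {0..T}" for t
  proof -
    have "((\<lambda>t. \<theta> 0 + (B t - B 0)) has_real_derivative b t) (at t within {0..T})"
      by (auto intro!: derivative_eq_intros B[OF t])
    then show ?thesis
      by (rule has_field_derivative_transform_within[OF _ zero_less_one t \<theta>_eq[symmetric]])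
  qed
  then show ?thesis
    unfolding mfg_nash_equilibrium_def using \<theta> w_deriv w_T
    by (intro conjI ballI exI[of _ w]) (auto simp: b_def)
qed

end
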